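(* Let $\lambda/\mu$ be a skew partition with $\mathrm{rank}(\lambda/\mu)=r$, and let $\mathcal{I}_0=\{(w_1,y_1),\ldots,(w_r,y_r)\}$ be its noncrossing interval set. Then \[ y(\lambda/\mu)=(-1)^{z(\lambda/\mu)}\det(d_{ij})_{i,j=1}^r,\qquad d_{ij}=\begin{cases}\dfrac{1}{y_j-w_i}, & y_j>w_i,\\[4pt] 0, & y_j<w_i.\end{cases} \]
   Context: A partition $\lambda$ has Young diagram $\{(i,j):1\le i\le\ell(\lambda),1\le j\le\lambda_i\}$; for $\mu\subseteq\lambda$ the skew partition $\lambda/\mu$ has diagram the diagram of $\lambda$ minus that of $\mu$. A border strip is a connected skew shape with no $2\times2$ square; its height is one less than its number of rows. A border strip $B\subseteq\lambda/\mu$ is a border strip of $\lambda/\mu$ if $\lambda/\mu-B$ is a skew partition $\nu/\mu$; it is maximal if it is not properly contained in another border strip of $\lambda/\mu$. $\mathrm{rank}(\lambda/\mu)$ is the minimal number of border strips into which the diagram of $\lambda/\mu$ can be partitioned. A greedy border strip decomposition of $\lambda/\mu$ is obtained by successively removing a maximal border strip from the current skew shape; it consists of $r$ border strips, and $z(\lambda/\mu)$ denotes the sum of the heights of its strips (this sum is determined by the shape $\lambda/\mu$). $s_{\lambda/\mu}(1^t)$ is the skew Schur function evaluated at $x_1=\cdots=x_t=1$, $x_i=0$ for $i>t$, a polynomial in $t$ divisible by $t^r$; $y(\lambda/\mu)=(t^{-r}s_{\lambda/\mu}(1^t))_{t=0}$. Snakes and interval sets: let $e_1,\ldots,e_k$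 be the edges of the bottom-right boundary lattice path of the diagram of $\lambda/\mu$ (unit steps up or right) from its bottom-leftmost to its top-rightmost point. For an edge $e$, if no square has $e$ as an edge, $S_e=\emptyset$; otherwise with $(i,j)$ the unique square having $e$ as an edge, $S_e=\lambda/\mu\cap\{(i,j),(i-1,j),(i-1,j-1),(i-2,j-1),\ldots\}$ if $e$ is horizontal, $S_e=\lambda/\mu\cap\{(i,j),(i,j-1),(i-1,j-1),(i-1,j-2),\ldots\}$ if $e$ is vertical. The length of a snake is its number of squares minus one; a right (left) snake is one of even length from a horizontal (vertical) edge. The snake sequence $q_1\cdots q_k$ records $L_m$ for a left snake of length $2m$, $R_m$ for a right snake of length $2m$, $O$ for odd length; it has exactly $r$ $L$'s and $r$ $R$'s. An interval set is a set of $r$ pairs $(u_i,v_i)$ with distinct $u_i$, distinct $v_i$, $1\le u_i<v_i\le k$, $u_i\ne v_j$ for all $i,j$, $q_{u_i}$ an $L$ and $q_{v_i}$ an $R$. The noncrossing interval set $\mathcal{I}_0$ is the unique interval set having no pairs $(i,j)$ with $u_i<u_j<v_i<v_j$. (Note $y_j\ne w_i$ for all $i,j$.)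
   Formalization: The words "horizontal" and "vertical" are interchanged in the definitions of the snakes and of left/right snakes: as written, the partition (1) has snake sequence R_0 L_0 and hence no interval set, though its rank is 1. *)

theory Defs
  imports
    "HOL-Library.Disjoint_Sets"
    "HOL-Library.Groups_Big_Fun"
    "HOL-Computational_Algebra.Polynomial"
    "Jordan_Normal_Form.Determinant"
begin

section \<open>Skew partitions\<close>

definition is_partition :: "nat list \<Rightarrow> bool" where
  "is_partition l \<longleftrightarrow> sorted_wrt (\<ge>) l \<and> 0 \<notin> set l"

text \<open>Rows and columns are numbered from 1, rows from top to bottom;
  parts beyond the length are 0.\<close>

definition part :: "nat list \<Rightarrow> nat \<Rightarrow> nat" where
  "part l i = (if 1 \<le> i \<and> i \<le> length l then l ! (i - 1) else 0)"

definition diagram :: "nat list \<Rightarrow> (nat \<times> nat) set" where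
  "diagram l = {(i, j). 1 \<le> i \<and> i \<le> length l \<and> 1 \<le> j \<and> j \<le> part l i}"

definition skew_partition :: "nat list \<Rightarrow> nat list \<Rightarrow> bool" where
  "skew_partition l m \<longleftrightarrow> is_partition l \<and> is_partition m \<and> diagram m \<subseteq> diagram l"

definition skew_diagram :: "nat list \<Rightarrow> nat list \<Rightarrow> (nat \<times> nat) set" where
  "skew_diagram l m = diagram l - diagram m"

section \<open>Border strips, rank, greedy decompositions\<close>

definition adjacent :: "nat \<times> nat \<Rightarrow> nat \<times> nat \<Rightarrow> bool" where
  "adjacent a b \<longleftrightarrow>
     (fst a = fst b \<and> (snd a = Suc (snd b) \<or> snd b = Suc (snd a))) \<or>
     (snd a = snd b \<and> (fst a = Suc (fst b) \<or> fst b = Suc (fst a)))"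

definition connected_squares :: "(nat \<times> nat) set \<Rightarrow> bool" where
  "connected_squares B \<longleftrightarrow>
     (\<forall>a\<in>B. \<forall>b\<in>B. (a, b) \<in> {(c, d). c \<in> B \<and> d \<in> B \<and> adjacent c d}\<^sup>*)"

text \<open>Border strips are understood to be nonempty.\<close>

definition border_strip :: "(nat \<times> nat) set \<Rightarrow> bool" where
  "border_strip B \<longleftrightarrow> B \<noteq> {} \<and>
     (\<exists>l m. skew_partition l m \<and> B = skew_diagram l m) \<and>
     connected_squares B \<and>
     \<not> (\<exists>i j. {(i, j), (i, j + 1), (i + 1, j), (i + 1, j + 1)} \<subseteq> B)"

definition strip_height :: "(nat \<times> nat) set \<Rightarrow> nat" where
  "strip_height B = card (fst ` B) - 1"

definition border_strip_of :: "nat list \<Rightarrow> nat list \<Rightarrow> (nat \<times> nat) set \<Rightarrow> bool" where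
  "border_strip_of l m B \<longleftrightarrow> border_strip B \<and> B \<subseteq> skew_diagram l m \<and>
     (\<exists>n. skew_partition n m \<and> skew_diagram l m - B = skew_diagram n m)"

definition maximal_border_strip_of :: "nat list \<Rightarrow> nat list \<Rightarrow> (nat \<times> nat) set \<Rightarrow> bool" where
  "maximal_border_strip_of l m B \<longleftrightarrow> border_strip_of l m B \<and>
     \<not> (\<exists>C. border_strip_of l m C \<and> B \<subset> C)"

definition skew_rank :: "nat list \<Rightarrow> nat list \<Rightarrow> nat" where
  "skew_rank l m = (LEAST n. \<exists>P. partition_on (skew_diagram l m) P \<and>
     (\<forall>B\<in>P. border_strip B) \<and> card P = n)"

text \<open>\<open>greedy_decomposition l m Bs\<close>: the strips in \<open>Bs\<close>, in the order
  of their removal, form a greedy border strip decomposition of \<open>l/m\<close>.\<close>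

inductive greedy_decomposition ::
  "nat list \<Rightarrow> nat list \<Rightarrow> (nat \<times> nat) set list \<Rightarrow> bool" where
  empty: "skew_partition l m \<Longrightarrow> skew_diagram l m = {} \<Longrightarrow> greedy_decomposition l m []"
| remove: "skew_partition l m \<Longrightarrow> maximal_border_strip_of l m B \<Longrightarrow>
     skew_partition n m \<Longrightarrow> skew_diagram n m = skew_diagram l m - B \<Longrightarrow>
     greedy_decomposition n m Bs \<Longrightarrow> greedy_decomposition l m (B # Bs)"

definition height_sum :: "(nat \<times> nat) set list \<Rightarrow> nat" where
  "height_sum Bs = (\<Sum>B\<leftarrow>Bs. strip_height B)"

section \<open>Skew Schur functions\<close>

text \<open>Semistandard tableaux with positive entries; the value off the diagram is fixed to 0
  so that distinct functions are distinct tableaux.\<close>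

definition ssyt :: "nat list \<Rightarrow> nat list \<Rightarrow> (nat \<times> nat \<Rightarrow> nat) set" where
  "ssyt l m = {T.
     (\<forall>s. s \<notin> skew_diagram l m \<longrightarrow> T s = 0) \<and>
     (\<forall>s\<in>skew_diagram l m. 1 \<le> T s) \<and>
     (\<forall>i j. (i, j) \<in> skew_diagram l m \<longrightarrow> (i, j + 1) \<in> skew_diagram l m \<longrightarrow>
        T (i, j) \<le> T (i, j + 1)) \<and>
     (\<forall>i j. (i, j) \<in> skew_diagram l m \<longrightarrow> (i + 1, j) \<in> skew_diagram l m \<longrightarrow>
        T (i, j) < T (i + 1, j))}"

text \<open>The value of the skew Schur function at a finitely supported
  sequence \<open>x 1, x 2, \<dots>\<close> of values: only finitely many tableaux contribute a nonzero
  monomial, so the infinite sum is the finite sum \<^const>\<open>Sum_any\<close>.\<close>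

definition skew_schur :: "nat list \<Rightarrow> nat list \<Rightarrow> (nat \<Rightarrow> 'a::comm_semiring_1) \<Rightarrow> 'a" where
  "skew_schur l m x =
     Sum_any (\<lambda>T. if T \<in> ssyt l m then \<Prod>s\<in>skew_diagram l m. x (T s) else 0)"

text \<open>\<open>s(1^t)\<close> as a polynomial in \<open>t\<close>.\<close>

definition skew_schur_ones :: "nat list \<Rightarrow> nat list \<Rightarrow> rat poly" where
  "skew_schur_ones l m = (THE p. \<forall>t::nat. poly p (of_nat t) =
     skew_schur l m (\<lambda>i. if 1 \<le> i \<and> i \<le> t then 1 else 0))"

text \<open>The polynomial division below is exact, \<open>t^r\<close> being a divisor of \<open>s(1^t)\<close>.\<close>

definition y_value :: "nat list \<Rightarrow> nat list \<Rightarrow> rat" where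
  "y_value l m = poly (skew_schur_ones l m div monom 1 (skew_rank l m)) 0"

section \<open>Snakes and interval sets\<close>

text \<open>\<open>Horiz i j\<close> is the bottom edge and \<open>Vert i j\<close> the right edge of the square \<open>(i, j)\<close>.\<close>

datatype edge = Horiz nat nat | Vert nat nat

text \<open>The path runs along the boundary of \<open>l\<close>, starting at the lower left corner of
  the lowest nonempty row \<open>b\<close> of the skew diagram and ending at the upper right corner of its
  highest nonempty row \<open>a\<close>. In each row it consists of the horizontal edges leading
  to column \<open>part l i\<close>, followed by one vertical edge. Where \<open>l\<close> and \<open>m\<close> agree, it passes
  through edges that belong to no square of the skew diagram.\<close>

definition boundary_path :: "nat list \<Rightarrow> nat list \<Rightarrow> edge list" where
  "boundary_path l m =
    (if skew_diagram l m = {} then []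
     else let a = Min (fst ` skew_diagram l m); b = Max (fst ` skew_diagram l m) in
       concat (map (\<lambda>i.
           map (Horiz i) [(if i = b then part m b else part l (i + 1)) + 1 ..< part l i + 1]
           @ [Vert i (part l i)])
         (rev [a ..< b + 1])))"

text \<open>An edge on the boundary of \<open>l\<close> can only be the bottom or right edge of
  a square of \<open>l/m\<close>, so \<open>(i, j)\<close> is the only candidate square. The snake of a horizontal edge is
  \<open>(i, j), (i, j - 1), (i - 1, j - 1), (i - 1, j - 2), \<dots>\<close>, that of a vertical edge is
  \<open>(i, j), (i - 1, j), (i - 1, j - 1), (i - 2, j - 1), \<dots>\<close>. Even-length snakes of horizontal
  edges are left snakes, those of vertical edges right snakes. In some texts the
  words ``horizontal'' and ``vertical'' are interchanged here; that is incompatible with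
  reading the path upwards and to the right, with the numbers of left and of
  right snakes both being equal to the rank, and with intervals leading from a left snake to a later right snake:
  the partition \<open>[2]\<close>, of rank 1, has edges \<open>Horiz 1 1, Horiz 1 2, Vert 1 2\<close> and must have
  one left and one right snake, in this order. Here its snake sequence is \<open>L 0, O, R 0\<close>, with
  the single interval \<open>(1, 3)\<close>; with the words interchanged it would be \<open>R 0, R 0, O\<close>.\<close>

fun snake :: "nat list \<Rightarrow> nat list \<Rightarrow> edge \<Rightarrow> (nat \<times> nat) set" where
  "snake l m (Horiz i j) =
     (if (i, j) \<in> skew_diagram l m
      then skew_diagram l m \<inter>
        {(c, d). \<exists>n. (c + n, d + n) = (i, j) \<or> (c + n, d + n + 1) = (i, j)}
      else {})"
| "snake l m (Vert i j) =
     (if (i, j) \<in> skew_diagram l m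
      then skew_diagram l m \<inter>
        {(c, d). \<exists>n. (c + n, d + n) = (i, j) \<or> (c + n + 1, d + n) = (i, j)}
      else {})"

text \<open>An empty snake has length \<open>-1\<close>, hence odd length.\<close>

definition snake_length :: "nat list \<Rightarrow> nat list \<Rightarrow> edge \<Rightarrow> int" where
  "snake_length l m e = int (card (snake l m e)) - 1"

datatype snake_symbol = LSnake nat | RSnake nat | OSnake

definition snake_symbol_of :: "nat list \<Rightarrow> nat list \<Rightarrow> edge \<Rightarrow> snake_symbol" where
  "snake_symbol_of l m e =
    (if odd (snake_length l m e) then OSnake
     else case e of
       Horiz _ _ \<Rightarrow> LSnake (nat (snake_length l m e div 2))
     | Vert _ _ \<Rightarrow> RSnake (nat (snake_length l m e div 2)))"

definition snake_sequence :: "nat list \<Rightarrow> nat list \<Rightarrow> snake_symbol list" where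
  "snake_sequence l m = map (snake_symbol_of l m) (boundary_path l m)"

text \<open>Positions in the snake sequence are numbered from 1.\<close>

definition interval_set :: "nat list \<Rightarrow> nat list \<Rightarrow> (nat \<times> nat) set \<Rightarrow> bool" where
  "interval_set l m I \<longleftrightarrow>
     finite I \<and> card I = skew_rank l m \<and> inj_on fst I \<and> inj_on snd I \<and>
     fst ` I \<inter> snd ` I = {} \<and>
     (\<forall>(u, v)\<in>I. 1 \<le> u \<and> u < v \<and> v \<le> length (snake_sequence l m) \<and>
        (\<exists>n. snake_sequence l m ! (u - 1) = LSnake n) \<and>
        (\<exists>n. snake_sequence l m ! (v - 1) = RSnake n))"

definition noncrossing_interval_set :: "nat list \<Rightarrow> nat list \<Rightarrow> (nat \<times> nat) set \<Rightarrow> bool" where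
  "noncrossing_interval_set l m I \<longleftrightarrow> interval_set l m I \<and>
     \<not> (\<exists>(u, v)\<in>I. \<exists>(u', v')\<in>I. u < u' \<and> u' < v \<and> v < v')"

end

theory Submission
  imports Defs
begin

text \<open>
  Encode a partition \<open>l\<close> by its beads \<open>l\<^sub>i - i\<close>. Specialising the Jacobi--Trudi determinant
  gives \<open>s(1\<^sup>t)\<close> as the determinant of the polynomials \<open>t (t + 1) \<dots> (t + n - 1) / n!\<close> at
  \<open>n = bead l i - bead m j\<close>. It is proved by induction on \<open>t\<close>: the differences of
  consecutive rows for \<open>t + 1\<close> are sums of rows for \<open>t\<close>, and by multilinearity they run over
  all ways to remove a horizontal strip, the squares with the largest entry. Every row whose bead is
  not a bead of \<open>m\<close> is divisible by \<open>t\<close>, with \<open>1/n\<close> or \<open>0\<close> remaining at \<open>t = 0\<close>, while the other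
  rows become unit vectors.

  Removing a border strip moves one bead to the left, over as many beads as the height of the
  strip. The number of squares on the diagonals, as a function of the content, rises at the
  beads of \<open>m\<close> and falls at those of \<open>l\<close>; a maximal strip covers a whole excursion of this function,
  so the greedy decomposition is the matching of parentheses, the beads of \<open>m\<close> alone being opening
  and those of \<open>l\<close> alone being closing ones. Left and right snakes sit at exactly these
  positions, so this is the noncrossing interval set, and permuting the columns
  of the determinant accordingly costs the sign given by the heights.
\<close>

section \<open>The Jacobi--Trudi determinant at \<open>1\<^sup>t\<close>\<close>

text \<open>The complete homogeneous symmetric function h_n at t ones, as a polynomial in t. The
  index is an integer so that the Jacobi-Trudi convention h_n = 0 for n < 0 is built in.\<close>

definition hpoly :: "int \<Rightarrow> rat poly" where
  "hpoly n = (if n < 0 then 0 else smult (1 / fact (nat n)) (pochhammer [:0, 1:] (nat n)))"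

lemma poly_pochhammer: "poly (pochhammer p n) x = pochhammer (poly p x) n"
  for p :: "'a::comm_semiring_1 poly"
  by (induction n) (simp_all add: pochhammer_Suc)

lemma poly_hpoly:
  "poly (hpoly n) x = (if n < 0 then 0 else pochhammer x (nat n) / fact (nat n))"
  by (simp add: hpoly_def poly_pochhammer)

lemma hpoly_neg [simp]: "n < 0 \<Longrightarrow> hpoly n = 0"
  by (simp add: hpoly_def)

lemma poly_hpoly_0: "poly (hpoly n) 0 = (if n = 0 then 1 else 0)"
  by (auto simp: poly_hpoly pochhammer_0_left)

text \<open>The recurrence h_n(1^(t+1)) = h_n(1^t) + h_(n-1)(1^(t+1)): a monomial either avoids the
  last variable or has one factor of it split off. As a polynomial identity it holds at every
  rational \<open>x\<close>.\<close>

lemma poly_hpoly_diff: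
  "poly (hpoly n) (x + 1) - poly (hpoly (n - 1)) (x + 1) = poly (hpoly n) x"
proof (cases "n \<le> 0")
  case True
  then show ?thesis by (cases "n = 0") (auto simp: poly_hpoly)
next
  case False
  then obtain k where k: "n = int (Suc k)"
    by (metis gr0_conv_Suc not_le zero_less_imp_eq_int)
  have n1: "nat n = Suc k" "nat (n - 1) = k" using k by auto
  have "pochhammer (x + 1) (Suc k) / fact (Suc k) - pochhammer (x + 1) k / fact k
     = (pochhammer (x + 1) (Suc k) - of_nat (Suc k) * pochhammer (x + 1) k) / fact (Suc k)"
    by (simp add: diff_divide_distrib del: of_nat_Suc)
  also have "pochhammer (x + 1) (Suc k) - of_nat (Suc k) * pochhammer (x + 1) k = pochhammer x (Suc k)"
    unfolding pochhammer_Suc[of "x + 1"] pochhammer_rec[of x] by (simp add: algebra_simps)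
  finally show ?thesis using False n1 by (simp add: poly_hpoly)
qed

text \<open>Lets the difference of entries in two consecutive rows of the determinant for t + 1
  become a sum of entries for t.\<close>

lemma poly_hpoly_telescope:
  "a \<le> b \<Longrightarrow> (\<Sum>k\<in>{a<..b}. poly (hpoly k) x) = poly (hpoly b) (x + 1) - poly (hpoly a) (x + 1)"
proof (induction b rule: int_ge_induct)
  case base
  then show ?case by simp
next
  case (step b)
  have "{a<..b + 1} = insert (b + 1) {a<..b}" using step by auto
  then show ?case using step poly_hpoly_diff[of "b + 1" x] by simp
qed

section \<open>Determinants: multilinearity, row differences, forced vanishing\<close>

lemma det_mat_fun:
  "det (mat n n (\<lambda>(i, j). g i j)) =
     (\<Sum>p\<in>{p. p permutes {0..<n}}. signof p * (\<Prod>i\<in>{0..<n}. g i (p i)))"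
proof -
  have "det (mat n n (\<lambda>(i, j). g i j)) = (\<Sum>p\<in>{p. p permutes {0..<n}}.
      signof p * (\<Prod>i\<in>{0..<n}. mat n n (\<lambda>(i, j). g i j) $$ (i, p i)))"
    by (simp add: det_def)
  also have "\<dots> = (\<Sum>p\<in>{p. p permutes {0..<n}}. signof p * (\<Prod>i\<in>{0..<n}. g i (p i)))"
    by (intro sum.cong refl arg_cong2[where f = "(*)"] prod.cong)
      (auto simp: permutes_in_image)
  finally show ?thesis .
qed

text \<open>Multilinearity in all rows at once: expanding the product of sums in each Leibniz term
  picks one summand \<open>f i\<close> from every row.\<close>

lemma det_mat_sum_PiE:
  assumes "\<And>i. i < n \<Longrightarrow> finite (C i)"
  shows "det (mat n n (\<lambda>(i, j). \<Sum>c\<in>C i. g i c j)) =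
     (\<Sum>f\<in>PiE {0..<n} C. det (mat n n (\<lambda>(i, j). g i (f i) j)))"
proof -
  have "det (mat n n (\<lambda>(i, j). \<Sum>c\<in>C i. g i c j)) = (\<Sum>p\<in>{p. p permutes {0..<n}}.
      \<Sum>f\<in>PiE {0..<n} C. signof p * (\<Prod>i\<in>{0..<n}. g i (f i) (p i)))"
    unfolding det_mat_fun
    by (intro sum.cong refl) (subst prod_sum_PiE, auto simp: assms sum_distrib_left)
  also have "\<dots> = (\<Sum>f\<in>PiE {0..<n} C. det (mat n n (\<lambda>(i, j). g i (f i) j)))"
    unfolding det_mat_fun by (rule sum.swap)
  finally show ?thesis .
qed

text \<open>Subtracting from each row its successor is left multiplication by the unitriangular
  matrix \<open>?U\<close>. The virtual row \<open>n\<close> vanishes, so the last row stays as it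
  is.\<close>

lemma det_row_differences:
  fixes g :: "nat \<Rightarrow> nat \<Rightarrow> 'a::comm_ring_1"
  assumes "\<And>j. j < n \<Longrightarrow> g n j = 0"
  shows "det (mat n n (\<lambda>(i, j). g i j - g (Suc i) j)) = det (mat n n (\<lambda>(i, j). g i j))"
proof -
  let ?U = "mat n n (\<lambda>(i, j). if i = j then 1 else if j = Suc i then - 1 else 0) :: 'a mat"
  let ?G = "mat n n (\<lambda>(i, j). g i j)"
  have "?U * ?G = mat n n (\<lambda>(i, j). g i j - g (Suc i) j)"
  proof (rule eq_matI)
    fix i j assume "i < dim_row (mat n n (\<lambda>(i, j). g i j - g (Suc i) j))"
      "j < dim_col (mat n n (\<lambda>(i, j). g i j - g (Suc i) j))"
    then have ij: "i < n" "j < n" by auto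
    have "(?U * ?G) $$ (i, j) =
        (\<Sum>k\<in>{0..<n}. (if k = i then g k j else 0) + (if k = Suc i then - g k j else 0))"
      using ij by (auto simp: scalar_prod_def intro!: sum.cong)
    also have "\<dots> = g i j - g (Suc i) j"
      using ij assms[OF ij(2)] by (cases "Suc i < n") (auto simp: sum.distrib not_less le_Suc_eq)
    finally show "(?U * ?G) $$ (i, j) = mat n n (\<lambda>(i, j). g i j - g (Suc i) j) $$ (i, j)"
      using ij by simp
  qed auto
  moreover have "det ?U = 1"
    by (subst det_upper_triangular[of _ n])
      (auto simp: upper_triangular_def prod_list_diag_prod)
  ultimately show ?thesis
    using det_mult[of ?U n ?G] by simp
qed

text \<open>The entries in rows \<open>k, ..., n - 1\<close> and columns \<open>0, ..., k\<close>
  have negative arguments, hence are 0. A permutation cannot send those n - k rows into the n - k -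
  1 columns beyond \<open>k\<close>, so every Leibniz term contains such an entry.\<close>

lemma det_eq_0_if_not_dominated:
  fixes L M :: "nat \<Rightarrow> int"
  assumes L: "\<And>i j. i < j \<Longrightarrow> j < n \<Longrightarrow> L j < L i"
    and M: "\<And>i j. i < j \<Longrightarrow> j < n \<Longrightarrow> M j < M i"
    and k: "k < n" "L k < M k"
    and F: "\<And>a. a < 0 \<Longrightarrow> F a = (0::'a::comm_ring_1)"
  shows "det (mat n n (\<lambda>(i, j). F (L i - M j))) = 0"
  unfolding det_mat_fun
proof (intro sum.neutral ballI)
  fix p assume "p \<in> {p. p permutes {0..<n}}"
  then have p: "p permutes {0..<n}" by simp
  have "\<exists>i\<in>{k..<n}. p i \<le> k"
  proof (rule ccontr)
    assume "\<not> ?thesis"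
    then have "p ` {k..<n} \<subseteq> {Suc k..<n}"
      using permutes_in_image[OF p] by (auto simp: not_le Suc_le_eq)
    then have "card (p ` {k..<n}) \<le> card {Suc k..<n}" by (intro card_mono) auto
    moreover have "card (p ` {k..<n}) = card {k..<n}"
      by (intro card_image inj_on_subset[OF permutes_inj[OF p]]) auto
    ultimately show False using k by auto
  qed
  then obtain i where i: "i \<in> {k..<n}" "p i \<le> k" by blast
  have "L i \<le> L k" using L[of k i] i by (cases "i = k") auto
  moreover have "M k \<le> M (p i)" using M[of "p i" k] i k by (cases "p i = k") auto
  ultimately have "F (L i - M (p i)) = 0" using k by (intro F) auto
  then have "(\<Prod>i\<in>{0..<n}. F (L i - M (p i))) = 0"
    using i by (intro prod_zero) (auto intro!: bexI[of _ i])
  then show "signof p * (\<Prod>i\<in>{0..<n}. F (L i - M (p i))) = 0" by simp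
qed

text \<open>Rows are numbered from 0 for functions on rows, but from 1 in diagrams.\<close>

definition region :: "nat \<Rightarrow> (nat \<Rightarrow> nat) \<Rightarrow> (nat \<Rightarrow> nat) \<Rightarrow> (nat \<times> nat) set" where
  "region N l m = {(Suc i, j) | i j. i < N \<and> m i < j \<and> j \<le> l i}"

text \<open>Shapes are functions on the first \<open>N\<close> rows, so cutting off a horizontal
  strip leads to an object of the same kind. The bound \<open>t\<close> expresses that only the
  first t variables are nonzero.\<close>

definition tableaux :: "nat \<Rightarrow> nat \<Rightarrow> (nat \<Rightarrow> nat) \<Rightarrow> (nat \<Rightarrow> nat) \<Rightarrow> (nat \<times> nat \<Rightarrow> nat) set" where
  "tableaux N t l m = {T.
     (\<forall>s. s \<notin> region N l m \<longrightarrow> T s = 0) \<and>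
     (\<forall>s\<in>region N l m. 1 \<le> T s \<and> T s \<le> t) \<and>
     (\<forall>i j. (i, j) \<in> region N l m \<longrightarrow> (i, j + 1) \<in> region N l m \<longrightarrow> T (i, j) \<le> T (i, j + 1)) \<and>
     (\<forall>i j. (i, j) \<in> region N l m \<longrightarrow> (i + 1, j) \<in> region N l m \<longrightarrow> T (i, j) < T (i + 1, j))}"

lemma mem_region: "(i, j) \<in> region N l m \<longleftrightarrow> 0 < i \<and> i \<le> N \<and> m (i - 1) < j \<and> j \<le> l (i - 1)"
  unfolding region_def by (cases i) auto

lemma finite_region [simp]: "finite (region N l m)"
proof (rule finite_subset)
  show "region N l m \<subseteq> (SIGMA i:{..N}. {..l (i - 1)})" by (auto simp: region_def)
qed auto

lemma finite_tableaux [simp]: "finite (tableaux N t l m)"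
proof (rule finite_subset)
  show "tableaux N t l m \<subseteq> {T. T ` region N l m \<subseteq> {..t} \<and> (\<forall>s. s \<notin> region N l m \<longrightarrow> T s = 0)}"
    by (auto simp: tableaux_def)
  show "finite {T::nat \<times> nat \<Rightarrow> nat. T ` region N l m \<subseteq> {..t} \<and> (\<forall>s. s \<notin> region N l m \<longrightarrow> T s = 0)}"
    using finite_set_of_finite_funs[of "region N l m" "{..t}" "0::nat"]
    by (auto elim!: rev_finite_subset)
qed

section \<open>Splitting a tableau at its largest entry\<close>

definition next_part :: "nat \<Rightarrow> (nat \<Rightarrow> nat) \<Rightarrow> nat \<Rightarrow> nat" where
  "next_part N l i = (if Suc i < N then l (Suc i) else 0)"

lemma tableauxD:
  assumes "T \<in> tableaux N t l m"
  shows "s \<notin> region N l m \<Longrightarrow> T s = 0"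
    and "s \<in> region N l m \<Longrightarrow> 1 \<le> T s"
    and "s \<in> region N l m \<Longrightarrow> T s \<le> t"
    and "(i, j) \<in> region N l m \<Longrightarrow> (i, j + 1) \<in> region N l m \<Longrightarrow> T (i, j) \<le> T (i, j + 1)"
    and "(i, j) \<in> region N l m \<Longrightarrow> (i + 1, j) \<in> region N l m \<Longrightarrow> T (i, j) < T (i + 1, j)"
  using assms unfolding tableaux_def by blast+

lemma tableaux_row_mono:
  assumes T: "T \<in> tableaux N t l m" and "(i, j) \<in> region N l m" "(i, j') \<in> region N l m" "j \<le> j'"
  shows "T (i, j) \<le> T (i, j')"
  using assms(4,3)
proof (induction j' rule: dec_induct)
  case base
  then show ?case by simp
next
  case (step k)
  then have k: "(i, k) \<in> region N l m" using assms(2) by (auto simp: mem_region)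
  then have "T (i, k) \<le> T (i, k + 1)" using step by (intro tableauxD(4)[OF T]) auto
  then show ?case using step k by auto
qed

text \<open>A horizontal strip is filled with the new largest entry \<open>Suc t\<close>. The
  interlacing condition \<open>l (Suc i) \<le> n i\<close> allows at most one new square per column,
  which keeps columns strict.\<close>

lemma tableaux_extend_mem:
  assumes l: "\<And>i. Suc i < N \<Longrightarrow> l (Suc i) \<le> l i"
    and m: "\<And>i. i < N \<Longrightarrow> m i \<le> n i"
    and n: "\<And>i. i < N \<Longrightarrow> n i \<le> l i" "\<And>i. Suc i < N \<Longrightarrow> l (Suc i) \<le> n i"
    and T: "T \<in> tableaux N t n m"
  shows "(\<lambda>s. if s \<in> region N l n then Suc t else T s) \<in> tableaux N (Suc t) l m"
proof -
  have reg: "s \<in> region N l m \<longleftrightarrow> s \<in> region N l n \<or> s \<in> region N n m" for s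
  proof (cases s)
    case (Pair i j)
    show ?thesis unfolding Pair mem_region
      using m[of "i - 1"] n[of "i - 1"] by auto linarith+
  qed
  have dis: "s \<notin> region N n m" if "s \<in> region N l n" for s
    using that by (cases s) (auto simp: mem_region)
  have T0: "T s = 0" if "s \<notin> region N n m" for s by (rule tableauxD(1)[OF T that])
  have Tb: "1 \<le> T s \<and> T s \<le> t" if "s \<in> region N n m" for s
    using tableauxD(2,3)[OF T that] by simp
  have Tr: "T (i, j) \<le> T (i, j + 1)" if "(i, j) \<in> region N n m" "(i, j + 1) \<in> region N n m" for i j
    by (rule tableauxD(4)[OF T that])
  have Tc: "T (i, j) < T (i + 1, j)" if "(i, j) \<in> region N n m" "(i + 1, j) \<in> region N n m" for i j
    by (rule tableauxD(5)[OF T that])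
  let ?T = "\<lambda>s. if s \<in> region N l n then Suc t else T s"
  have "?T (i, j) \<le> ?T (i, j + 1)"
    if "(i, j) \<in> region N l m" "(i, j + 1) \<in> region N l m" for i j
  proof (cases "(i, j + 1) \<in> region N l n")
    case True
    then show ?thesis using that reg Tb by (auto simp: le_SucI)
  next
    case False
    then have "(i, j + 1) \<in> region N n m" using that reg by blast
    moreover from False that have "(i, j) \<notin> region N l n" by (auto simp: mem_region)
    moreover from this have "(i, j) \<in> region N n m" using that reg by blast
    ultimately show ?thesis using Tr False by simp
  qed
  moreover have "?T (i, j) < ?T (i + 1, j)"
    if "(i, j) \<in> region N l m" "(i + 1, j) \<in> region N l m" for i j
  proof -
    have "(i, j) \<notin> region N l n"
      using that n(2)[of "i - 1"] by (auto simp: mem_region)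
    moreover from this have "(i, j) \<in> region N n m" using that reg by blast
    ultimately show ?thesis
      using that reg[of "(i + 1, j)"] Tb[of "(i, j)"] Tc[of i j] by auto
  qed
  moreover have "\<forall>s. s \<notin> region N l m \<longrightarrow> ?T s = 0" using reg T0 by auto
  moreover have "\<forall>s\<in>region N l m. 1 \<le> ?T s \<and> ?T s \<le> Suc t"
  proof
    fix s assume "s \<in> region N l m"
    then show "1 \<le> ?T s \<and> ?T s \<le> Suc t" using reg[of s] Tb[of s] by auto
  qed
  ultimately show ?thesis unfolding tableaux_def by blast
qed

text \<open>Rows increase weakly, so the entries at most \<open>t\<close> form an initial segment of
  each row. The ends of these segments are the inner shape \<open>n\<close>.\<close>

lemma tableaux_split:
  assumes l: "\<And>i. Suc i < N \<Longrightarrow> l (Suc i) \<le> l i"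
    and m: "\<And>i. Suc i < N \<Longrightarrow> m (Suc i) \<le> m i"
    and ml: "\<And>i. i < N \<Longrightarrow> m i \<le> l i"
    and T: "T \<in> tableaux N (Suc t) l m"
  obtains n T' where "n \<in> PiE {0..<N} (\<lambda>i. {max (m i) (next_part N l i)..l i})"
    "T' \<in> tableaux N t n m" "T = (\<lambda>s. if s \<in> region N l n then Suc t else T' s)"
proof -
  have T0: "T s = 0" if "s \<notin> region N l m" for s by (rule tableauxD(1)[OF T that])
  have Tb: "1 \<le> T s \<and> T s \<le> Suc t" if "s \<in> region N l m" for s
    using tableauxD(2,3)[OF T that] by simp
  have Tr: "T (i, j) \<le> T (i, j + 1)" if "(i, j) \<in> region N l m" "(i, j + 1) \<in> region N l m" for i j
    by (rule tableauxD(4)[OF T that])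
  have Tc: "T (i, j) < T (i + 1, j)" if "(i, j) \<in> region N l m" "(i + 1, j) \<in> region N l m" for i j
    by (rule tableauxD(5)[OF T that])
  \<comment> \<open>Inserting \<open>m i\<close> makes the maximum defined and yields
    \<open>n i = m i\<close> for a row without entries at most \<open>t\<close>.\<close>
  define S where "S i = insert (m i) {j. m i < j \<and> j \<le> l i \<and> T (Suc i, j) \<le> t}" for i
  define n where "n = restrict (\<lambda>i. Max (S i)) {0..<N}"
  have finS: "finite (S i)" for i unfolding S_def by auto
  have n_in: "n i \<in> S i" if "i < N" for i
    using Max_in[OF finS[of i]] that by (auto simp: n_def S_def)
  have n_max: "j \<le> n i" if "i < N" "j \<in> S i" for i j
    using Max_ge[OF finS[of i] that(2)] that by (simp add: n_def)
  have mn: "m i \<le> n i" if "i < N" for i using n_max[OF that, of "m i"] by (simp add: S_def)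
  have nl: "n i \<le> l i" if "i < N" for i using n_in[OF that] ml[OF that] by (auto simp: S_def)
  have key: "T (Suc i, j) \<le> t \<longleftrightarrow> j \<le> n i" if "i < N" "m i < j" "j \<le> l i" for i j
  proof
    assume "T (Suc i, j) \<le> t"
    then show "j \<le> n i" using that n_max[of i j] by (simp add: S_def)
  next
    assume le: "j \<le> n i"
    then have "T (Suc i, n i) \<le> t" using n_in[of i] that by (auto simp: S_def)
    moreover have "T (Suc i, j) \<le> T (Suc i, n i)"
      using that le nl[of i] by (intro tableaux_row_mono[OF T]) (auto simp: mem_region)
    ultimately show "T (Suc i, j) \<le> t" by simp
  qed
  \<comment> \<open>The square above the last square of the next row has, by column strictness, an
    entry at most \<open>t\<close>, so the initial segment reaches it.\<close>
  have ln: "l (Suc i) \<le> n i" if i: "Suc i < N" for i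
  proof (rule ccontr)
    assume "\<not> ?thesis"
    then have lt: "n i < l (Suc i)" by simp
    have "(Suc i, l (Suc i)) \<in> region N l m" "(Suc i + 1, l (Suc i)) \<in> region N l m"
      using i lt mn[of i] l[OF i] m[OF i] by (auto simp: mem_region)
    from Tc[OF this] Tb[OF this(2)] have "T (Suc i, l (Suc i)) \<le> t" by simp
    then have "l (Suc i) \<le> n i" using key[of i "l (Suc i)"] i lt mn[of i] l[OF i] by auto
    then show False using lt by simp
  qed
  define T' where "T' s = (if s \<in> region N n m then T s else 0)" for s
  have sub: "region N n m \<subseteq> region N l m"
  proof (intro subsetI)
    fix s assume "s \<in> region N n m"
    then show "s \<in> region N l m" using nl by (fastforce simp: region_def)
  qed
  have "T' \<in> tableaux N t n m"
  proof -
    have *: "1 \<le> T s \<and> T s \<le> t" if sn: "s \<in> region N n m" for s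
    proof -
      obtain i j where s: "s = (Suc i, j)" and ij: "i < N" "m i < j" "j \<le> n i"
        using sn by (auto simp: region_def)
      then have "j \<le> l i" using nl[of i] by simp
      then show ?thesis using key[of i j] Tb[of s] sn sub ij by (auto simp: s)
    qed
    show ?thesis unfolding tableaux_def T'_def mem_Collect_eq
      using * Tr Tc subsetD[OF sub] by (intro conjI ballI allI impI) simp_all
  qed
  moreover have "T = (\<lambda>s. if s \<in> region N l n then Suc t else T' s)"
  proof
    fix s :: "nat \<times> nat"
    obtain i j where s: "s = (i, j)" by (cases s)
    consider "s \<in> region N l n" | "s \<in> region N n m" | "s \<notin> region N l n" "s \<notin> region N n m" by blast
    then show "T s = (if s \<in> region N l n then Suc t else T' s)"
    proof cases
      case 1
      then obtain i where i: "s = (Suc i, j)" "i < N" "n i < j" "j \<le> l i" by (auto simp: s region_def)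
      then have "m i < j" using mn[of i] by simp
      then have "T s = Suc t" using Tb[of s] key[of i j] i by (auto simp: mem_region)
      then show ?thesis using 1 by simp
    next
      case 2
      then show ?thesis by (auto simp: T'_def s mem_region)
    next
      case 3
      then have "s \<notin> region N l m" by (auto simp: s mem_region)
      then show ?thesis using 3 T0 by (simp add: T'_def)
    qed
  qed
  moreover have "n \<in> PiE {0..<N} (\<lambda>i. {max (m i) (next_part N l i)..l i})"
    using mn nl ln by (auto simp: next_part_def n_def)
  ultimately show thesis by (rule that[rotated 1])
qed

text \<open>The branching rule. The shape \<open>n\<close> is recovered from the squares carrying
  \<open>Suc t\<close> and the smaller tableau from the other squares, so the splitting is a
  bijection.\<close>

lemma card_tableaux_Suc:
  assumes l: "\<And>i. Suc i < N \<Longrightarrow> l (Suc i) \<le> l i"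
    and m: "\<And>i. Suc i < N \<Longrightarrow> m (Suc i) \<le> m i"
    and ml: "\<And>i. i < N \<Longrightarrow> m i \<le> l i"
  shows "card (tableaux N (Suc t) l m) =
    (\<Sum>n\<in>PiE {0..<N} (\<lambda>i. {max (m i) (next_part N l i)..l i}). card (tableaux N t n m))"
proof -
  let ?P = "PiE {0..<N} (\<lambda>i. {max (m i) (next_part N l i)..l i})"
  let ?f = "\<lambda>(n, T). (\<lambda>s. if s \<in> region N l n then Suc t else T s) :: nat \<times> nat \<Rightarrow> nat"
  have P: "m i \<le> n i \<and> n i \<le> l i" if "n \<in> ?P" "i < N" for n i
    using PiE_mem[OF that(1), of i] that(2) by auto
  have P': "l (Suc i) \<le> n i" if "n \<in> ?P" "Suc i < N" for n i
    using PiE_mem[OF that(1), of i] that(2) by (auto simp: next_part_def)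
  have "bij_betw ?f (SIGMA n:?P. tableaux N t n m) (tableaux N (Suc t) l m)"
  proof (rule bij_betw_imageI)
    show "inj_on ?f (SIGMA n:?P. tableaux N t n m)"
    proof (rule inj_onI, clarify)
      fix n T n' T' assume nP: "n \<in> ?P" and n'P: "n' \<in> ?P"
        and T: "T \<in> tableaux N t n m" and T': "T' \<in> tableaux N t n' m"
        and "(\<lambda>s. if s \<in> region N l n then Suc t else T s) = (\<lambda>s. if s \<in> region N l n' then Suc t else T' s)"
      then have eq: "(if s \<in> region N l n then Suc t else T s) = (if s \<in> region N l n' then Suc t else T' s)" for s
        by metis
      have b: "T s < Suc t" "T' s < Suc t" for s
        using tableauxD(1,3)[OF T, of s] tableauxD(1,3)[OF T', of s] by (force simp: less_Suc_eq_le)+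
      have reg: "s \<in> region N l n \<longleftrightarrow> s \<in> region N l n'" for s
        using eq[of s] b[of s] by (auto split: if_splits)
      have "n i = n' i" if "i < N" for i
      proof (rule ccontr)
        assume "n i \<noteq> n' i"
        then consider "n i < n' i" | "n' i < n i" by linarith
        then show False
          using reg[of "(Suc i, n' i)"] reg[of "(Suc i, n i)"] P[OF nP that] P[OF n'P that] that
          by cases (auto simp: mem_region)
      qed
      then have nn: "n = n'" using nP n'P by (intro PiE_ext[OF nP n'P]) auto
      have "T s = T' s" for s
      proof (cases "s \<in> region N l n")
        case True
        then have "s \<notin> region N n m" by (cases s) (auto simp: mem_region)
        then show ?thesis using tableauxD(1)[OF T, of s] tableauxD(1)[OF T', of s] nn by simp
      next
        case False
        then show ?thesis using eq[of s] nn by simp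
      qed
      then show "n = n' \<and> T = T'" using nn by auto
    qed
    show "?f ` (SIGMA n:?P. tableaux N t n m) = tableaux N (Suc t) l m"
    proof (intro equalityI subsetI)
      fix T assume "T \<in> ?f ` (SIGMA n:?P. tableaux N t n m)"
      then obtain n T' where n: "n \<in> ?P" and T': "T' \<in> tableaux N t n m" and T: "T = ?f (n, T')" by auto
      show "T \<in> tableaux N (Suc t) l m"
        unfolding T prod.case
        by (rule tableaux_extend_mem[where n = n and m = m]) (use l T' P[OF n] P'[OF n] in auto)
    next
      fix T assume "T \<in> tableaux N (Suc t) l m"
      then obtain n T' where "n \<in> ?P" "T' \<in> tableaux N t n m"
        "T = (\<lambda>s. if s \<in> region N l n then Suc t else T' s)"
        using tableaux_split[of N l m T t, OF l m ml] by blast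
      then show "T \<in> ?f ` (SIGMA n:?P. tableaux N t n m)"
        by (intro image_eqI[of _ _ "(n, T')"]) auto
    qed
  qed
  from bij_betw_same_card[OF this, symmetric]
  have "card (tableaux N (Suc t) l m) = card (SIGMA n:?P. tableaux N t n m)" .
  also have "\<dots> = (\<Sum>n\<in>?P. card (tableaux N t n m))"
    by (intro card_SigmaI) (auto intro!: finite_PiE)
  finally show ?thesis .
qed

section \<open>The determinant formula by induction on the number of variables\<close>

text \<open>At t = 0 the entries are 1 for equal beads and 0 otherwise. Equal shapes give the
  identity matrix and the empty tableau; different shapes admit no tableau and give a zero
  row.\<close>

lemma card_tableaux_0:
  assumes l: "\<And>i j. i < j \<Longrightarrow> j < N \<Longrightarrow> l j \<le> l i"
    and m: "\<And>i j. i < j \<Longrightarrow> j < N \<Longrightarrow> m j \<le> m i"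
    and ml: "\<And>i. i < N \<Longrightarrow> m i \<le> l i"
  shows "of_nat (card (tableaux N 0 l m)) =
    det (mat N N (\<lambda>(i, j). poly (hpoly (int (l i) - int i - (int (m j) - int j))) 0))"
proof (cases "\<exists>i<N. m i < l i")
  case False
  then have eq: "l i = m i" if "i < N" for i using ml[OF that] that by force
  have reg: "region N l m = {}" using eq by (auto simp: region_def)
  then have "tableaux N 0 l m = {\<lambda>_. 0}" by (auto simp: tableaux_def)
  moreover have "mat N N (\<lambda>(i, j). poly (hpoly (int (l i) - int i - (int (m j) - int j))) 0) = 1\<^sub>m N"
  proof (rule eq_matI)
    fix i j assume "i < dim_row (1\<^sub>m N :: rat mat)" "j < dim_col (1\<^sub>m N :: rat mat)"
    then have ij: "i < N" "j < N" by auto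
    have "int (l i) - int i - (int (m j) - int j) = 0 \<longleftrightarrow> i = j"
      using eq[OF ij(1)] m[of i j] m[of j i] ij by (cases i j rule: linorder_cases) auto
    then show "mat N N (\<lambda>(i, j). poly (hpoly (int (l i) - int i - (int (m j) - int j))) 0) $$ (i, j)
        = (1\<^sub>m N :: rat mat) $$ (i, j)"
      using ij by (simp add: poly_hpoly_0)
  qed auto
  ultimately show ?thesis by simp
next
  case True
  \<comment> \<open>In the first row where the shapes differ, the bead of \<open>l\<close> lies
    strictly between the beads of \<open>m\<close> in this row and the row above, so it equals no
    bead of \<open>m\<close> and the row is zero.\<close>
  define i where "i = (LEAST i. i < N \<and> m i < l i)"
  have i: "i < N" "m i < l i" using LeastI_ex[OF True] by (auto simp: i_def)
  have before: "l j = m j" if "j < i" for j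
    using not_less_Least[of j "\<lambda>i. i < N \<and> m i < l i"] that i ml[of j] by (force simp: i_def)
  have "tableaux N 0 l m = {}"
  proof -
    have "(Suc i, l i) \<in> region N l m" using i by (auto simp: mem_region)
    then show ?thesis by (force simp: tableaux_def)
  qed
  moreover have "det (mat N N (\<lambda>(i, j). poly (hpoly (int (l i) - int i - (int (m j) - int j))) 0)) = 0"
    unfolding det_mat_fun
  proof (intro sum.neutral ballI)
    fix p assume "p \<in> {p. p permutes {0..<N}}"
    then have p: "p permutes {0..<N}" by simp
    have "int (l i) - int i - (int (m (p i)) - int (p i)) \<noteq> 0"
    proof (cases "p i < i")
      case True
      then show ?thesis using before[OF True] l[OF True] i by auto
    next
      case False
      moreover have "p i < N" using permutes_in_image[OF p, of i] i by auto
      ultimately show ?thesis using m[of i "p i"] i by (cases "p i = i") auto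
    qed
    then have "(\<Prod>i\<in>{0..<N}. poly (hpoly (int (l i) - int i - (int (m (p i)) - int (p i)))) 0) = 0"
      using i by (intro prod_zero) (auto simp: poly_hpoly_0 intro!: bexI[of _ i])
    then show "signof p * (\<Prod>i\<in>{0..<N}. poly (hpoly (int (l i) - int i - (int (m (p i)) - int (p i)))) 0) = 0"
      by simp
  qed
  ultimately show ?thesis by simp
qed

lemma antimono_on_Suc:
  fixes l :: "nat \<Rightarrow> nat"
  assumes "\<And>i. Suc i < N \<Longrightarrow> l (Suc i) \<le> l i" "i < j" "j < N"
  shows "l j \<le> l i"
  using assms(2,3)
proof (induction j)
  case (Suc j)
  then show ?case using assms(1)[of j] by (cases "i = j") auto
qed auto

text \<open>The Jacobi-Trudi formula at 1^t. The inner shape \<open>m\<close> stays fixed during the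
  induction while \<open>l\<close> varies, since the largest entries sit on the outer
  boundary.\<close>

theorem card_tableaux_eq_det:
  assumes l: "\<And>i. Suc i < N \<Longrightarrow> l (Suc i) \<le> l i"
    and m: "\<And>i. Suc i < N \<Longrightarrow> m (Suc i) \<le> m i"
    and ml: "\<And>i. i < N \<Longrightarrow> m i \<le> l i"
  shows "of_nat (card (tableaux N t l m)) =
    det (mat N N (\<lambda>(i, j). poly (hpoly (int (l i) - int i - (int (m j) - int j))) (of_nat t)))"
  using l ml
proof (induction t arbitrary: l)
  case 0
  then show ?case using card_tableaux_0[of N l m] antimono_on_Suc[of N l] antimono_on_Suc[of N m] m by auto
next
  case (Suc t)
  let ?M = "\<lambda>j. int (m j) - int j"
  let ?C = "\<lambda>i. {next_part N l i..l i}"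
  \<comment> \<open>The bead of an empty row is appended at index \<open>N\<close>; it lies left of
    all beads of \<open>m\<close>, so the row belonging to it is zero and row differences
    apply.\<close>
  let ?L = "\<lambda>i. if i < N then int (l i) - int i else - int N"
  let ?D = "\<lambda>n. det (mat N N (\<lambda>(i, j). poly (hpoly (int (n i) - int i - ?M j)) (of_nat t)))"
  have C: "next_part N l i \<le> l i" if "i < N" for i using Suc.prems(1) by (auto simp: next_part_def)
  have row: "poly (hpoly (?L i - ?M j)) (of_nat t + 1) - poly (hpoly (?L (Suc i) - ?M j)) (of_nat t + 1)
      = (\<Sum>c\<in>?C i. poly (hpoly (int c - int i - ?M j)) (of_nat t))" if "i < N" "j < N" for i j
  proof -
    have Suc_i: "?L (Suc i) = int (next_part N l i) - int i - 1"
      using that by (auto simp: next_part_def)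
    have "(\<Sum>c\<in>?C i. poly (hpoly (int c - int i - ?M j)) (of_nat t)) =
        (\<Sum>k\<in>{?L (Suc i) - ?M j<..?L i - ?M j}. poly (hpoly k) (of_nat t))"
      unfolding Suc_i using that
      by (intro sum.reindex_bij_witness[of _ "\<lambda>k. nat (k + int i + ?M j)" "\<lambda>c. int c - int i - ?M j"]) auto
    also have "\<dots> = poly (hpoly (?L i - ?M j)) (of_nat t + 1) - poly (hpoly (?L (Suc i) - ?M j)) (of_nat t + 1)"
      using C[OF that(1)] that(1) unfolding Suc_i by (intro poly_hpoly_telescope) auto
    finally show ?thesis by simp
  qed
  have "det (mat N N (\<lambda>(i, j). poly (hpoly (int (l i) - int i - ?M j)) (of_nat (Suc t)))) =
      det (mat N N (\<lambda>(i, j). poly (hpoly (?L i - ?M j)) (of_nat t + 1)))"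
    by (intro arg_cong[of _ _ det] cong_mat) (auto simp: add.commute)
  also have "\<dots> = det (mat N N (\<lambda>(i, j). poly (hpoly (?L i - ?M j)) (of_nat t + 1)
      - poly (hpoly (?L (Suc i) - ?M j)) (of_nat t + 1)))"
    by (subst det_row_differences) auto
  also have "\<dots> = det (mat N N (\<lambda>(i, j). \<Sum>c\<in>?C i. poly (hpoly (int c - int i - ?M j)) (of_nat t)))"
    by (intro arg_cong[of _ _ det] cong_mat) (use row in auto)
  also have "\<dots> = (\<Sum>n\<in>PiE {0..<N} ?C. ?D n)"
    by (rule det_mat_sum_PiE) auto
  \<comment> \<open>Multilinearity also produces shapes \<open>n\<close> that fail to contain
    \<open>m\<close>; their determinants vanish because some bead of \<open>n\<close> is left of the
    corresponding bead of \<open>m\<close>.\<close>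
  also have "\<dots> = (\<Sum>n\<in>PiE {0..<N} (\<lambda>i. {max (m i) (next_part N l i)..l i}). ?D n)"
  proof (rule sum.mono_neutral_right)
    show "PiE {0..<N} (\<lambda>i. {max (m i) (next_part N l i)..l i}) \<subseteq> PiE {0..<N} ?C"
      by (intro PiE_mono) auto
    show "\<forall>n\<in>PiE {0..<N} ?C - PiE {0..<N} (\<lambda>i. {max (m i) (next_part N l i)..l i}). ?D n = 0"
    proof
      fix n assume n: "n \<in> PiE {0..<N} ?C - PiE {0..<N} (\<lambda>i. {max (m i) (next_part N l i)..l i})"
      then have nC: "next_part N l i \<le> n i \<and> n i \<le> l i" if "i < N" for i
        using that by (auto simp: PiE_iff)
      obtain k where k: "k < N" "n k < m k"
        using n nC by (force simp: PiE_iff extensional_def not_le)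
      have "n (Suc i) \<le> n i" if "Suc i < N" for i
        using nC[of i] nC[of "Suc i"] that by (auto simp: next_part_def)
      then have "n j \<le> n i" if "i < j" "j < N" for i j using antimono_on_Suc[of N n i j] that by auto
      moreover have "m j \<le> m i" if "i < j" "j < N" for i j using antimono_on_Suc[of N m i j] m that by auto
      ultimately show "?D n = 0"
        by (intro det_eq_0_if_not_dominated[of N "\<lambda>i. int (n i) - int i" ?M k "\<lambda>a. poly (hpoly a) (of_nat t)"])
          (use k in force)+
    qed
  qed (auto intro!: finite_PiE)
  also have "\<dots> = (\<Sum>n\<in>PiE {0..<N} (\<lambda>i. {max (m i) (next_part N l i)..l i}). of_nat (card (tableaux N t n m)))"
  proof (intro sum.cong refl)
    fix n assume n: "n \<in> PiE {0..<N} (\<lambda>i. {max (m i) (next_part N l i)..l i})"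
    have nC: "m i \<le> n i \<and> next_part N l i \<le> n i \<and> n i \<le> l i" if "i < N" for i
      using PiE_mem[OF n, of i] that by auto
    show "?D n = of_nat (card (tableaux N t n m))"
    proof (rule Suc.IH[symmetric])
      show "n (Suc i) \<le> n i" if "Suc i < N" for i
        using nC[of i] nC[of "Suc i"] that by (auto simp: next_part_def)
    qed (use nC in auto)
  qed
  also have "\<dots> = of_nat (card (tableaux N (Suc t) l m))"
    using card_tableaux_Suc[of N l m t] Suc.prems m by simp
  finally show ?case by simp
qed

text \<open>The beads are the positions of the vertical edges of the boundary path, extended by
  the empty rows. Since the latter are present, the bead sets of \<open>l\<close> and \<open>m\<close> agree far
  to the left, and only their difference matters.\<close>

definition bead :: "nat list \<Rightarrow> nat \<Rightarrow> int" where
  "bead l i = int (part l (Suc i)) - int (Suc i)"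

section \<open>Parts of partitions, and s(1^t) as a polynomial determinant\<close>

lemma part_eq_0 [simp]: "length l < i \<Longrightarrow> part l i = 0"
  by (simp add: part_def)

lemma is_partition_part_mono:
  assumes "is_partition l" "1 \<le> i" "i \<le> j"
  shows "part l j \<le> part l i"
proof (cases "j \<le> length l \<and> i \<noteq> j")
  case True
  then have "l ! (i - 1) \<ge> l ! (j - 1)"
    using assms sorted_wrt_nth_less[of "(\<ge>)" l "i - 1" "j - 1"] by (auto simp: is_partition_def)
  then show ?thesis using True assms by (simp add: part_def)
qed (use assms in \<open>auto simp: part_def\<close>)

lemma is_partition_part_pos:
  assumes "is_partition l" "1 \<le> i" "i \<le> length l"
  shows "0 < part l i"
proof -
  have "l ! (i - 1) \<in> set l" using assms by (intro nth_mem) auto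
  then show ?thesis using assms by (metis bot_nat_0.not_eq_extremum is_partition_def part_def)
qed

lemma mem_diagram: "(i, j) \<in> diagram l \<longleftrightarrow> 1 \<le> i \<and> 1 \<le> j \<and> j \<le> part l i"
  by (auto simp: diagram_def part_def split: if_splits)

lemma diagram_subset_iff: "diagram m \<subseteq> diagram l \<longleftrightarrow> (\<forall>i\<ge>1. part m i \<le> part l i)"
proof
  assume sub: "diagram m \<subseteq> diagram l"
  show "\<forall>i\<ge>1. part m i \<le> part l i"
  proof (intro allI impI)
    fix i :: nat assume "1 \<le> i"
    then show "part m i \<le> part l i"
      using subsetD[OF sub, of "(i, part m i)"] by (cases "part m i") (auto simp: mem_diagram)
  qed
qed (auto simp: mem_diagram; meson le_trans)

lemma skew_partition_iff:
  "skew_partition l m \<longleftrightarrow> is_partition l \<and> is_partition m \<and> (\<forall>i\<ge>1. part m i \<le> part l i)"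
  by (simp add: skew_partition_def diagram_subset_iff)

lemma mem_skew_diagram: "(i, j) \<in> skew_diagram l m \<longleftrightarrow> 1 \<le> i \<and> part m i < j \<and> j \<le> part l i"
  by (auto simp: skew_diagram_def mem_diagram)

lemma skew_diagram_eq_region:
  assumes "length l \<le> N"
  shows "skew_diagram l m = region N (\<lambda>i. part l (Suc i)) (\<lambda>i. part m (Suc i))"
proof -
  have "part l i = 0" if "N < i" for i using assms that by simp
  then have "i \<le> N" if "(i, j) \<in> skew_diagram l m" for i j
    using that by (metis bot_nat_0.extremum_uniqueI less_le_not_le mem_skew_diagram not_le not_less_zero)
  then show ?thesis by (auto simp: mem_region mem_skew_diagram)
qed

text \<open>At this 0-1 sequence a tableau contributes 1 if all its entries are at most
  \<open>t\<close> and 0 otherwise, which leaves a finite count.\<close>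

lemma skew_schur_indicator:
  assumes "length l \<le> N"
  shows "skew_schur l m (\<lambda>i. if 1 \<le> i \<and> i \<le> t then 1 else 0) =
    (of_nat (card (tableaux N t (\<lambda>i. part l (Suc i)) (\<lambda>i. part m (Suc i)))) :: 'a::comm_semiring_1)"
proof -
  let ?R = "region N (\<lambda>i. part l (Suc i)) (\<lambda>i. part m (Suc i))"
  let ?T = "tableaux N t (\<lambda>i. part l (Suc i)) (\<lambda>i. part m (Suc i))"
  note R = skew_diagram_eq_region[OF assms, of m]
  let ?f = "\<lambda>T. if T \<in> ssyt l m then \<Prod>s\<in>skew_diagram l m. (if 1 \<le> T s \<and> T s \<le> t then 1 else 0) else (0::'a)"
  have f: "?f T = (if T \<in> ?T then 1 else 0)" for T
  proof (cases "T \<in> ssyt l m \<and> (\<forall>s\<in>?R. T s \<le> t)")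
    case True
    then have "T \<in> ?T" unfolding ssyt_def tableaux_def R by blast
    moreover have "\<forall>s\<in>?R. 1 \<le> T s" using True unfolding ssyt_def R by blast
    ultimately show ?thesis using True unfolding R by (auto intro!: prod.neutral)
  next
    case False
    then have "T \<notin> ?T" unfolding ssyt_def tableaux_def R by blast
    moreover have "?f T = 0"
    proof (cases "T \<in> ssyt l m")
      case True
      then obtain s where "s \<in> ?R" "\<not> T s \<le> t" using False by blast
      then have "(\<Prod>s\<in>?R. (if 1 \<le> T s \<and> T s \<le> t then 1 else 0)) = (0::'a)"
        by (intro prod_zero) auto
      then show ?thesis unfolding R by simp
    qed auto
    ultimately show ?thesis by simp
  qed
  have "skew_schur l m (\<lambda>i. if 1 \<le> i \<and> i \<le> t then 1 else 0) = Sum_any (\<lambda>T. if T \<in> ?T then 1 else (0::'a))"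
    unfolding skew_schur_def f ..
  also have "\<dots> = (\<Sum>T\<in>?T. if T \<in> ?T then 1 else 0)"
    by (rule Sum_any.expand_superset) auto
  also have "\<dots> = of_nat (card ?T)" by simp
  finally show ?thesis .
qed

lemma poly_det: "poly (det (mat n n (\<lambda>(i, j). g i j))) x = det (mat n n (\<lambda>(i, j). poly (g i j) x))"
  for g :: "nat \<Rightarrow> nat \<Rightarrow> 'a::comm_ring_1 poly"
  unfolding det_mat_fun by (auto simp: poly_sum poly_prod sign_def intro!: sum.cong)

text \<open>A rational polynomial is determined by its values at the natural numbers, which settles
  the definite description. The shift by one in \<open>bead\<close> cancels in the
  differences.\<close>

lemma skew_schur_ones_eq_det:
  assumes sk: "skew_partition l m" and N: "length l \<le> N"
  shows "skew_schur_ones l m = det (mat N N (\<lambda>(i, j). hpoly (bead l i - bead m j)))"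
proof -
  let ?P = "det (mat N N (\<lambda>(i, j). hpoly (bead l i - bead m j)))"
  let ?s = "\<lambda>t. skew_schur l m (\<lambda>i. if 1 \<le> i \<and> i \<le> t then 1 else 0) :: rat"
  have P: "poly ?P (of_nat t) = ?s t" for t
  proof -
    have "?s t = det (mat N N (\<lambda>(i, j). poly (hpoly (int (part l (Suc i)) - int i
        - (int (part m (Suc j)) - int j))) (of_nat t)))"
      unfolding skew_schur_indicator[OF N]
      by (rule card_tableaux_eq_det)
        (use sk in \<open>auto simp: skew_partition_iff is_partition_part_mono\<close>)
    then show ?thesis unfolding poly_det by (simp add: bead_def algebra_simps)
  qed
  show ?thesis unfolding skew_schur_ones_def
  proof (rule the_equality)
    show "\<forall>t. poly ?P (of_nat t) = ?s t" using P by blast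
  next
    fix p assume p: "\<forall>t. poly p (of_nat t) = ?s t"
    have "p - ?P = 0"
    proof (rule ccontr)
      assume "p - ?P \<noteq> 0"
      then have "finite {x. poly (p - ?P) x = 0}" by (rule poly_roots_finite)
      moreover have "range of_nat \<subseteq> {x. poly (p - ?P) x = 0}" using p P by auto
      ultimately have "finite (range (of_nat :: nat \<Rightarrow> rat))" by (rule rev_finite_subset)
      then show False using finite_imageD[of "of_nat :: nat \<Rightarrow> rat" UNIV] by (simp add: inj_on_def)
    qed
    then show "p = ?P" by simp
  qed
qed

section \<open>Beads, diagonals and border strips\<close>

definition sq_content :: "nat \<times> nat \<Rightarrow> int" where
  "sq_content s = int (snd s) - int (fst s)"

lemma sq_content_simp [simp]: "sq_content (i, j) = int j - int i"
  by (simp add: sq_content_def)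

text \<open>The number of squares on the diagonal of content \<open>x\<close>, counted by rows: row
  \<open>i\<close> occupies exactly the contents from \<open>bead m i + 1\<close> to
  \<open>bead l i\<close>.\<close>

definition depth :: "nat list \<Rightarrow> nat list \<Rightarrow> int \<Rightarrow> nat" where
  "depth l m x = card {i. bead m i < x \<and> x \<le> bead l i}"

lemma bead_decreasing: "is_partition l \<Longrightarrow> i < j \<Longrightarrow> bead l j < bead l i"
  using is_partition_part_mono[of l "Suc i" "Suc j"] by (simp add: bead_def)

lemma bead_less_iff: "is_partition l \<Longrightarrow> bead l i < bead l j \<longleftrightarrow> j < i"
  using bead_decreasing[of l i j] bead_decreasing[of l j i] by (cases i j rule: linorder_cases) auto

lemma bead_le_iff: "is_partition l \<Longrightarrow> bead l i \<le> bead l j \<longleftrightarrow> j \<le> i"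
  using bead_less_iff[of l j i] by auto

lemma bead_eq_iff: "is_partition l \<Longrightarrow> bead l i = bead l j \<longleftrightarrow> i = j"
  by (auto simp: order_eq_iff[of "bead l i"] bead_le_iff)

lemma bead_ge: "- int (Suc i) \<le> bead l i"
  by (simp add: bead_def)

lemma bead_beyond: "length l \<le> i \<Longrightarrow> bead l i = - int (Suc i)"
  by (simp add: bead_def)

lemma skew_partition_beads:
  "skew_partition l m \<longleftrightarrow> is_partition l \<and> is_partition m \<and> (\<forall>i. bead m i \<le> bead l i)"
proof -
  have "(\<forall>i\<ge>1. part m i \<le> part l i) \<longleftrightarrow> (\<forall>i. part m (Suc i) \<le> part l (Suc i))"
    by (metis One_nat_def Suc_le_D Suc_leI zero_less_Suc)
  then show ?thesis by (simp add: skew_partition_iff bead_def)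
qed

lemma mem_skew_beads:
  "(Suc i, j) \<in> skew_diagram l m \<longleftrightarrow> bead m i < sq_content (Suc i, j) \<and> sq_content (Suc i, j) \<le> bead l i"
  by (auto simp: mem_skew_diagram bead_def)

lemma skew_diagramE:
  assumes "c \<in> skew_diagram l m"
  obtains i j where "c = (Suc i, j)" "bead m i < sq_content c" "sq_content c \<le> bead l i"
proof -
  obtain i j where c: "c = (i, j)" by (cases c)
  then obtain i' where "i = Suc i'" using assms by (cases i) (auto simp: mem_skew_diagram)
  then show thesis using that[of i' j] assms c mem_skew_beads by simp
qed

lemma skew_diagram_mono:
  assumes "\<And>i. bead n i \<le> bead l i"
  shows "skew_diagram n m \<subseteq> skew_diagram l m"
proof
  fix c assume "c \<in> skew_diagram n m"
  then obtain i j where "c = (Suc i, j)" "bead m i < sq_content c" "sq_content c \<le> bead n i"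
    by (rule skew_diagramE)
  then show "c \<in> skew_diagram l m" using assms[of i] by (simp add: mem_skew_beads)
qed

lemma square_with_content:
  assumes "bead m i < x" "x \<le> bead l i"
  obtains j where "(Suc i, j) \<in> skew_diagram l m" "sq_content (Suc i, j) = x"
proof -
  have "int (nat (x + int (Suc i))) = x + int (Suc i)" using assms bead_ge[of i m] by simp
  then show thesis using that[of "nat (x + int (Suc i))"] assms by (simp add: mem_skew_beads)
qed

lemma finite_beads_ge: "finite {i. x \<le> bead l i}"
proof (rule finite_subset)
  show "{i. x \<le> bead l i} \<subseteq> {..max (length l) (nat (- x))}"
  proof (intro subsetI CollectI)
    fix i assume "i \<in> {i. x \<le> bead l i}"
    then show "i \<in> {..max (length l) (nat (- x))}"
      using bead_beyond[of l i] by (cases "length l \<le> i") auto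
  qed
qed simp

lemma finite_depth_set [simp]: "finite {i. bead m i < x \<and> x \<le> bead l i}"
  by (rule finite_subset[OF _ finite_beads_ge[of x l]]) auto

lemma depth_pos_iff: "0 < depth l m x \<longleftrightarrow> (\<exists>i. bead m i < x \<and> x \<le> bead l i)"
  by (auto simp: depth_def card_gt_0_iff)

lemma card_sq_content: "card {c \<in> skew_diagram l m. sq_content c = x} = depth l m x"
  unfolding depth_def
proof (rule bij_betw_same_card[of "\<lambda>c. fst c - 1"], rule bij_betw_imageI)
  show "inj_on (\<lambda>c. fst c - 1) {c \<in> skew_diagram l m. sq_content c = x}"
  proof (rule inj_onI)
    fix c d assume c: "c \<in> {c \<in> skew_diagram l m. sq_content c = x}"
      and d: "d \<in> {c \<in> skew_diagram l m. sq_content c = x}" and eq: "fst c - 1 = fst d - 1"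
    from c obtain i j where "c = (Suc i, j)" by (auto elim: skew_diagramE)
    moreover from d obtain i' j' where "d = (Suc i', j')" by (auto elim: skew_diagramE)
    ultimately show "c = d" using c d eq by auto
  qed
  show "(\<lambda>c. fst c - 1) ` {c \<in> skew_diagram l m. sq_content c = x} = {i. bead m i < x \<and> x \<le> bead l i}"
  proof (intro equalityI subsetI)
    fix i assume "i \<in> {i. bead m i < x \<and> x \<le> bead l i}"
    then have "bead m i < x" "x \<le> bead l i" by auto
    then obtain j where "(Suc i, j) \<in> skew_diagram l m" "sq_content (Suc i, j) = x"
      by (rule square_with_content)
    then show "i \<in> (\<lambda>c. fst c - 1) ` {c \<in> skew_diagram l m. sq_content c = x}"
      by (intro image_eqI[of _ _ "(Suc i, j)"]) auto
  qed (auto elim!: skew_diagramE)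
qed

text \<open>The depth at x is the number of beads of \<open>l\<close> at or right of x minus that of
  \<open>m\<close>. Passing to x + 1 loses just a bead at x itself.\<close>

lemma depth_diff:
  assumes sk: "skew_partition l m"
  shows "int (depth l m x) - int (depth l m (x + 1)) =
    of_bool (x \<in> range (bead l)) - of_bool (x \<in> range (bead m))"
proof -
  have le: "bead m i \<le> bead l i" for i using sk by (simp add: skew_partition_beads)
  have *: "int (depth l m y) = int (card {i. y \<le> bead l i}) - int (card {i. y \<le> bead m i})" for y
  proof -
    have sub: "{i. y \<le> bead m i} \<subseteq> {i. y \<le> bead l i}" using le by (auto intro: order_trans)
    have "{i. bead m i < y \<and> y \<le> bead l i} = {i. y \<le> bead l i} - {i. y \<le> bead m i}" by auto
    then have "depth l m y = card {i. y \<le> bead l i} - card {i. y \<le> bead m i}"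
      unfolding depth_def using card_Diff_subset[OF finite_beads_ge sub] by simp
    then show ?thesis using card_mono[OF finite_beads_ge sub] by simp
  qed
  have step: "int (card {i. x \<le> bead k i}) = int (card {i. x + 1 \<le> bead k i}) + of_bool (x \<in> range (bead k))"
    if "is_partition k" for k
  proof (cases "x \<in> range (bead k)")
    case True
    then obtain i where i: "x = bead k i" by auto
    then have "{i. x \<le> bead k i} = insert i {i. x + 1 \<le> bead k i}"
      using bead_eq_iff[OF that] by force
    then show ?thesis using True i finite_beads_ge[of "x + 1" k] by simp
  next
    case False
    then have "{i. x \<le> bead k i} = {i. x + 1 \<le> bead k i}" by (force simp: order_le_less)
    then show ?thesis using False by simp
  qed
  show ?thesis using step[of l] step[of m] sk unfolding * by (simp add: skew_partition_beads)
qed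

text \<open>Adding i + 1 to a strictly decreasing integer sequence gives a weakly decreasing one,
  here eventually 0. Its positive values are the parts.\<close>

lemma ex_partition_beads:
  assumes dec: "\<And>i. g (Suc i) < g i" and far: "\<And>i. N \<le> i \<Longrightarrow> g i = - int (Suc i)"
  shows "\<exists>n. is_partition n \<and> bead n = g"
proof -
  define f where "f i = g i + int (Suc i)" for i
  have f_Suc: "f (Suc i) \<le> f i" for i using dec[of i] by (simp add: f_def)
  have f_mono: "f j \<le> f i" if "i \<le> j" for i j
    using that by (induction rule: dec_induct) (use f_Suc order_trans in blast)+
  have f0: "f i = 0" if "N \<le> i" for i using far[OF that] by (simp add: f_def)
  have f_ge: "0 \<le> f i" for i using f_mono[of i "max i N"] f0[of "max i N"] by simp
  \<comment> \<open>The list ends before the first zero, as a partition has no zero parts.\<close>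
  define k where "k = (LEAST k. f k = 0)"
  have fk: "f k = 0" unfolding k_def by (rule LeastI[of _ N]) (simp add: f0)
  have fpos: "0 < f i" if "i < k" for i
    using not_less_Least[of i "\<lambda>k. f k = 0"] that f_ge[of i] by (simp add: k_def)
  define n where "n = map (\<lambda>i. nat (f i)) [0..<k]"
  have "sorted_wrt (\<ge>) n"
    unfolding sorted_wrt_iff_nth_less n_def using f_mono by (auto intro: nat_mono)
  moreover have "0 \<notin> set n" using fpos by (force simp: n_def)
  moreover have "bead n i = g i" for i
  proof (cases "i < k")
    case True
    then show ?thesis using f_ge[of i] by (simp add: bead_def part_def n_def f_def)
  next
    case False
    then have "f i = 0" using f_mono[of k i] f_ge[of i] fk by simp
    then show ?thesis using False by (simp add: bead_def part_def n_def f_def)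
  qed
  ultimately show ?thesis by (auto simp: is_partition_def)
qed

text \<open>The last square of a nonempty row shows its bead; in an empty row the bead is that of
  \<open>m\<close>.\<close>

lemma skew_diagram_inj:
  assumes n: "skew_partition n m" and n': "skew_partition n' m"
    and eq: "skew_diagram n m = skew_diagram n' m"
  shows "bead n = bead n'"
proof (rule ext, rule ccontr)
  fix i assume ne: "bead n i \<noteq> bead n' i"
  have le: "bead n1 i \<ge> bead n2 i" if "skew_partition n1 m" "skew_partition n2 m"
    "skew_diagram n2 m = skew_diagram n1 m" for n1 n2
  proof (rule ccontr)
    assume less: "\<not> bead n1 i \<ge> bead n2 i"
    then have "bead m i < bead n2 i" using that(1) by (auto simp: skew_partition_beads not_le intro: le_less_trans)
    then obtain j where "(Suc i, j) \<in> skew_diagram n2 m" "sq_content (Suc i, j) = bead n2 i"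
      using square_with_content by blast
    then have "bead n2 i \<le> bead n1 i" using that(3) by (simp add: mem_skew_beads)
    then show False using less by simp
  qed
  show False using le[OF n n'] le[OF n' n] eq ne by simp
qed

section \<open>Contents of border strips and removal of rim strips\<close>

definition strip_relation :: "(nat \<times> nat) set \<Rightarrow> ((nat \<times> nat) \<times> (nat \<times> nat)) set" where
  "strip_relation B = {(c, d). c \<in> B \<and> d \<in> B \<and> adjacent c d}"

lemma sym_strip_relation: "sym (strip_relation B)"
  by (auto simp: sym_def strip_relation_def adjacent_def)

text \<open>A discrete intermediate value property: contents of adjacent squares differ by
  one.\<close>

lemma connected_squares_contents:
  assumes B: "connected_squares B" and cd: "c \<in> B" "d \<in> B" and x: "sq_content c \<le> x" "x \<le> sq_content d"
  shows "x \<in> sq_content ` B"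
proof -
  have "(c, d) \<in> (strip_relation B)\<^sup>*"
    using B cd by (auto simp: connected_squares_def strip_relation_def)
  then have "{sq_content c..sq_content d} \<subseteq> sq_content ` B"
  proof induction
    case base
    then show ?case using cd by auto
  next
    case (step d e)
    then have e: "e \<in> B" "adjacent d e" by (auto simp: strip_relation_def)
    then have "\<bar>sq_content d - sq_content e\<bar> = 1" by (auto simp: adjacent_def sq_content_def)
    then have "{sq_content c..sq_content e} \<subseteq> insert (sq_content e) {sq_content c..sq_content d}" by auto
    then show ?case using step.IH e by blast
  qed
  then show ?thesis using x by auto
qed

text \<open>Two squares on one diagonal of a skew shape force, by convexity of the shape, a 2 by 2
  square at the upper one.\<close>

lemma border_strip_content_inj:
  assumes B: "border_strip B"
  shows "inj_on sq_content B"
proof -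
  obtain l m where sk: "skew_partition l m" and Beq: "B = skew_diagram l m"
    using B by (auto simp: border_strip_def)
  have no: "\<not> {(i, j), (i, j + 1), (i + 1, j), (i + 1, j + 1)} \<subseteq> B" for i j
    using B by (auto simp: border_strip_def)
  have pl: "part l i' \<le> part l i" "part m i' \<le> part m i" if "1 \<le> i" "i \<le> i'" for i i'
    using sk that by (auto simp: skew_partition_iff is_partition_part_mono)
  have key: "fst c \<ge> fst d" if "c \<in> B" "d \<in> B" "sq_content c = sq_content d" for c d
  proof (rule ccontr)
    assume "\<not> fst c \<ge> fst d"
    moreover obtain i j where c: "c = (i, j)" by (cases c)
    moreover obtain i' j' where d: "d = (i', j')" by (cases d)
    ultimately have "i < i'" "j < j'" using that by auto
    then have "{(i, j), (i, j + 1), (i + 1, j), (i + 1, j + 1)} \<subseteq> B"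
      using that pl[of i "i + 1"] pl[of "i + 1" i'] pl[of i i']
      by (auto simp: Beq c d mem_skew_diagram)
    then show False using no by blast
  qed
  show ?thesis
  proof (rule inj_onI)
    fix c d assume "c \<in> B" "d \<in> B" "sq_content c = sq_content d"
    with key[of c d] key[of d c] show "c = d" by (auto simp: sq_content_def prod_eq_iff)
  qed
qed

text \<open>Removing the part of the rim with contents in \<open>(a, b]\<close> moves the bead at \<open>b\<close> to the
  free position \<open>a\<close>; it jumps over the beads in rows \<open>s + 1, \<dots>, t\<close>.\<close>

lemma rim_strip:
  assumes sk: "skew_partition l m" and a: "a \<notin> range (bead l)" "a < bead l s"
    and pos: "\<And>x. a < x \<Longrightarrow> x \<le> bead l s \<Longrightarrow> 0 < depth l m x"
  obtains n t where "skew_partition n m" "s \<le> t" "a < bead l t" "bead l (Suc t) < a"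
    "bead n = (\<lambda>i. if s \<le> i \<and> i < t then bead l (Suc i) else if i = t then a else bead l i)"
    "border_strip_of l m (skew_diagram l m - skew_diagram n m)"
    "skew_diagram l m - skew_diagram n m = {c \<in> skew_diagram l m. a < sq_content c \<and> sq_content c \<le> bead l s \<and>
       bead l (fst c) < sq_content c}"
    "strip_height (skew_diagram l m - skew_diagram n m) = t - s"
proof -
  have pl: "is_partition l" and pm: "is_partition m" and ml: "\<And>i. bead m i \<le> bead l i"
    using sk by (auto simp: skew_partition_beads)
  \<comment> \<open>The lowest row whose bead lies right of \<open>a\<close>, which is the last bead
    jumped over.\<close>
  define t where "t = Max {i. a + 1 \<le> bead l i}"
  have t_set: "t \<in> {i. a + 1 \<le> bead l i}" unfolding t_def
    by (rule Max_in[OF finite_beads_ge]) (use a(2) in \<open>auto intro!: exI[of _ s]\<close>)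
  have t_max: "i \<le> t" if "a < bead l i" for i
    unfolding t_def by (rule Max_ge[OF finite_beads_ge]) (use that in auto)
  have st: "s \<le> t" using t_max a by auto
  have at: "a < bead l t" using t_set by auto
  have at': "bead l (Suc t) < a"
    using t_max[of "Suc t"] a(1) by (metis Suc_n_not_le_n linorder_neqE_linordered_idom rangeI)
  define g where "g = (\<lambda>i. if s \<le> i \<and> i < t then bead l (Suc i) else if i = t then a else bead l i)"
  have dec: "bead l (Suc i) < bead l i" for i using bead_decreasing[OF pl] by simp
  have t_len: "t < length l"
    using at at' bead_beyond[of l t] bead_beyond[of l "Suc t"] by (cases "t < length l") auto
  have "g (Suc i) < g i" for i
  proof -
    consider "Suc i < s" | "Suc i = s" | "s \<le> i" "Suc i < t" | "s \<le> i" "Suc i = t" | "i = t" | "t < i"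
      using st by linarith
    then show ?thesis
      by cases (use st at at' dec[of i] dec[of "Suc i"] in \<open>auto simp: g_def\<close>)
  qed
  moreover have "g i = - int (Suc i)" if "length l \<le> i" for i
    using that t_len bead_beyond[OF that] by (simp add: g_def)
  ultimately obtain n where pn: "is_partition n" and bn: "bead n = g"
    using ex_partition_beads by blast
  have mg: "bead m i \<le> g i" for i
  proof -
    \<comment> \<open>Here nonempty diagonals keep the new shape above \<open>m\<close>. A row
      \<open>k\<close> meeting diagonal x + 1 has \<open>bead m k \<le> x\<close>, and it is not
      below row \<open>i\<close> because row \<open>Suc i\<close> of \<open>l\<close> ends at
      content x or earlier.\<close>
    have *: "bead m i \<le> x" if "a \<le> x" "x < bead l s" "bead l (Suc i) \<le> x" for x
    proof -
      obtain k where k: "bead m k < x + 1" "x + 1 \<le> bead l k"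
        using pos[of "x + 1"] \<open>a \<le> x\<close> \<open>x < bead l s\<close> by (auto simp: depth_pos_iff)
      then have "bead l (Suc i) < bead l k" using \<open>bead l (Suc i) \<le> x\<close> by simp
      then have "k \<le> i" using bead_less_iff[OF pl] by simp
      then have "bead m i \<le> bead m k" using bead_le_iff[OF pm] by simp
      then show ?thesis using k by simp
    qed
    consider "s \<le> i" "i < t" | "i = t" | "i < s \<or> t < i" using st by linarith
    then show ?thesis
    proof cases
      case 1
      have "a < bead l (Suc i)" using 1 at bead_le_iff[OF pl, of t "Suc i"] by simp
      moreover have "bead l (Suc i) < bead l s" using 1 bead_less_iff[OF pl] by simp
      ultimately show ?thesis using *[of "bead l (Suc i)"] 1 by (simp add: g_def)
    next
      case 2
      then show ?thesis using *[of a] a at' by (simp add: g_def)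
    next
      case 3
      then have "g i = bead l i" using st by (auto simp: g_def)
      then show ?thesis using ml by simp
    qed
  qed
  have gl: "g i \<le> bead l i" for i using dec[of i] at by (auto simp: g_def intro: less_imp_le)
  have nm: "skew_partition n m" and ln: "skew_partition l n"
    using pn pl pm mg gl bn by (auto simp: skew_partition_beads)
  define B where "B = skew_diagram l m - skew_diagram n m"
  \<comment> \<open>The squares removed are those with content in the interval whose lower right
    diagonal neighbour is outside \<open>l\<close>, that is, a segment of the outer rim.\<close>
  have rows: "g i < x \<and> x \<le> bead l i \<longleftrightarrow> a < x \<and> x \<le> bead l s \<and> bead l (Suc i) < x \<and> x \<le> bead l i" for i x
  proof -
    consider "i < s" | "s \<le> i" "i < t" | "i = t" | "t < i" using st by linarith
    then show ?thesis
    proof cases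
      case 1
      then have "bead l s \<le> bead l (Suc i)" using bead_le_iff[OF pl] by simp
      then show ?thesis using 1 st by (auto simp: g_def)
    next
      case 2
      then have "bead l i \<le> bead l s" "a < bead l (Suc i)"
        using at bead_le_iff[OF pl, of t "Suc i"] bead_le_iff[OF pl, of i s] by auto
      then show ?thesis using 2 by (auto simp: g_def)
    next
      case 3
      then show ?thesis using st at' bead_le_iff[OF pl, of t s] by (auto simp: g_def)
    next
      case 4
      then have "bead l i \<le> bead l (Suc t)" using bead_le_iff[OF pl] by simp
      then show ?thesis using 4 at' st by (auto simp: g_def)
    qed
  qed
  have B_mem: "(Suc i, j) \<in> B \<longleftrightarrow> g i < sq_content (Suc i, j) \<and> sq_content (Suc i, j) \<le> bead l i" for i j
    using mg[of i] by (auto simp: B_def mem_skew_beads bn)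
  have B_eq: "B = skew_diagram l n"
  proof (rule Set.set_eqI)
    fix c :: "nat \<times> nat"
    obtain i j where c: "c = (i, j)" by (cases c)
    show "c \<in> B \<longleftrightarrow> c \<in> skew_diagram l n"
    proof (cases i)
      case 0
      then show ?thesis by (simp add: c B_def mem_skew_diagram)
    next
      case (Suc i')
      then show ?thesis by (simp only: c B_mem mem_skew_beads bn)
    qed
  qed
  have B_set: "B = {c \<in> skew_diagram l m. a < sq_content c \<and> sq_content c \<le> bead l s \<and> bead l (fst c) < sq_content c}"
  proof (rule Set.set_eqI)
    fix c
    show "c \<in> B \<longleftrightarrow> c \<in> {c \<in> skew_diagram l m. a < sq_content c \<and> sq_content c \<le> bead l s \<and> bead l (fst c) < sq_content c}"
    proof (cases "c \<in> skew_diagram l m")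
      case True
      then obtain i j where c: "c = (Suc i, j)" by (rule skew_diagramE)
      show ?thesis using True rows[of i "sq_content c"] B_mem[of i j] by (auto simp: c mem_skew_beads)
    qed (auto simp: B_def)
  qed
  have B_row: "\<exists>j. (Suc i, j) \<in> B \<and> sq_content (Suc i, j) = x"
    if "a < x" "x \<le> bead l s" "bead l (Suc i) < x" "x \<le> bead l i" for i x
  proof -
    have "g i < x" using rows[of i x] that by simp
    then show ?thesis using square_with_content[of n i x l] that bn B_eq by metis
  qed
  obtain js where top: "(Suc s, js) \<in> B" "sq_content (Suc s, js) = bead l s"
    using B_row[of "bead l s" s] a dec[of s] by auto
  have BE: "\<exists>i j. c = (Suc i, j) \<and> a < sq_content c \<and> sq_content c \<le> bead l s \<and> bead l (Suc i) < sq_content c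
      \<and> sq_content c \<le> bead l i" if "c \<in> B" for c
  proof -
    from that obtain i j where c: "c = (Suc i, j)" using skew_diagramE[of c l n] B_eq by metis
    then show ?thesis using that rows[of i "sq_content c"] B_mem by blast
  qed
  have conn: "(c, (Suc s, js)) \<in> (strip_relation B)\<^sup>*" if "c \<in> B" for c
    using that
  proof (induction "nat (bead l s - sq_content c)" arbitrary: c rule: less_induct)
    case (less c)
    obtain i j where c: "c = (Suc i, j)" "a < sq_content c" "sq_content c \<le> bead l s"
      "bead l (Suc i) < sq_content c" "sq_content c \<le> bead l i" using BE[OF less.prems] by blast
    show ?case
    proof (cases "sq_content c = bead l s")
      case True
      then have "i = s" using c bead_le_iff[OF pl, of s i] bead_less_iff[OF pl, of "Suc i" s] by simp
      moreover from this have "j = js" using True top c by simp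
      ultimately show ?thesis using c by simp
    next
      case False
      \<comment> \<open>One step along the rim towards its top square: to the right while the row
        continues, otherwise up. The content grows by one each time.\<close>
      define d where "d = (if sq_content c < bead l i then (Suc i, Suc j) else (i, j))"
      have "d \<in> B \<and> sq_content d = sq_content c + 1 \<and> adjacent c d"
      proof (cases "sq_content c < bead l i")
        case True
        then have "d = (Suc i, Suc j)" by (simp add: d_def)
        moreover from this have "d \<in> B"
          using rows[of i "sq_content c + 1"] B_mem[of i "Suc j"] c False True by simp
        ultimately show ?thesis using c by (simp add: adjacent_def)
      next
        case f: False
        then have ci: "sq_content c = bead l i" using c by simp
        then have "s < i" using False c bead_less_iff[OF pl, of i s] by simp
        then obtain k where k: "i = Suc k" by (cases i) auto
        have "sq_content c + 1 \<le> bead l k" using ci dec[of k] k by simp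
        then have "g k < sq_content c + 1 \<and> sq_content c + 1 \<le> bead l k"
          using rows[of k "sq_content c + 1"] c False ci k by simp
        then have "(Suc k, j) \<in> B" using B_mem[of k j] c k by simp
        then show ?thesis using c k f by (simp add: d_def adjacent_def)
      qed
      then have d: "d \<in> B" "sq_content d = sq_content c + 1" "adjacent c d" by auto
      then have "(d, (Suc s, js)) \<in> (strip_relation B)\<^sup>*" using less.hyps[of d] c False by simp
      moreover have "(c, d) \<in> strip_relation B" using d less.prems by (simp add: strip_relation_def)
      ultimately show ?thesis by (rule converse_rtrancl_into_rtrancl[rotated])
    qed
  qed
  have "connected_squares B"
    unfolding connected_squares_def strip_relation_def[symmetric]
    using conn symD[OF sym_rtrancl[OF sym_strip_relation]] by (blast intro: rtrancl_trans)
  \<comment> \<open>The lower right square of a 2 by 2 block has the same content as the upper left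
    one, whose diagonal successor is outside \<open>l\<close>.\<close>
  moreover have "\<not> (\<exists>i j. {(i, j), (i, j + 1), (i + 1, j), (i + 1, j + 1)} \<subseteq> B)"
  proof clarify
    fix i j assume *: "{(i, j), (i, j + 1), (i + 1, j), (i + 1, j + 1)} \<subseteq> B"
    then have "(i, j) \<in> B" by auto
    then obtain k where "i = Suc k" "bead l (Suc k) < sq_content (i, j)" using BE by blast
    moreover have "sq_content (Suc (Suc k), j + 1) \<le> bead l (Suc k)"
      using * \<open>i = Suc k\<close> B_mem[of "Suc k" "j + 1"] by simp
    ultimately show False by simp
  qed
  ultimately have strip: "border_strip B"
    unfolding border_strip_def using top B_eq ln by blast
  have diff: "skew_diagram l m - B = skew_diagram n m"
  proof -
    have "skew_diagram n m \<subseteq> skew_diagram l m"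
      using gl bn by (intro skew_diagram_mono) simp
    then show ?thesis by (auto simp: B_def)
  qed
  have "border_strip_of l m B"
    unfolding border_strip_of_def using strip nm diff by (auto simp: B_def)
  moreover have "strip_height B = t - s"
  proof -
    \<comment> \<open>Each row from \<open>s\<close> to \<open>t\<close> contributes at least its
      last square, of content \<open>bead l i\<close>.\<close>
    have "fst ` B = Suc ` {s..t}"
    proof (intro equalityI subsetI)
      fix r assume "r \<in> fst ` B"
      then obtain c where c: "c \<in> B" "r = fst c" by blast
      obtain i j where i: "c = (Suc i, j)" "a < sq_content c" "sq_content c \<le> bead l s"
        "bead l (Suc i) < sq_content c" "sq_content c \<le> bead l i" using BE[OF c(1)] by blast
      then have "i \<le> t" using t_max[of i] by simp
      moreover have "bead l (Suc i) < bead l s" using i by simp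
      then have "s \<le> i" using bead_less_iff[OF pl] by simp
      ultimately show "r \<in> Suc ` {s..t}" using c i by simp
    next
      fix r assume "r \<in> Suc ` {s..t}"
      then obtain i where "r = Suc i" "i \<in> {s..t}" by blast
      then have i: "r = Suc i" "s \<le> i" "i \<le> t" by auto
      then have "a < bead l i" "bead l i \<le> bead l s"
        using at bead_le_iff[OF pl, of t i] bead_le_iff[OF pl, of i s] by auto
      then obtain j where "(Suc i, j) \<in> B" using B_row[of "bead l i" i] dec[of i] by auto
      then show "r \<in> fst ` B" using i by force
    qed
    then show ?thesis using st by (simp add: strip_height_def card_image)
  qed
  ultimately show thesis
    using that[OF nm st at at'] B_set bn unfolding B_def g_def by blast
qed

section \<open>Greedy decompositions and the rank\<close>

text \<open>Only finitely many diagonals are nonempty, so \<open>x\<close> lies in a maximal run of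
  them, bounded by empty diagonals at \<open>a\<close> and \<open>b + 1\<close>.\<close>

lemma depth_run:
  assumes sk: "skew_partition l m" and x: "0 < depth l m x"
  obtains a b where "a < x" "x \<le> b" "depth l m a = 0" "depth l m (b + 1) = 0"
    "\<And>z. a < z \<Longrightarrow> z \<le> b \<Longrightarrow> 0 < depth l m z"
proof -
  have lo: "depth l m z = 0" if "z \<le> - int (length l) - 1" for z
  proof (rule ccontr)
    assume "depth l m z \<noteq> 0"
    then have "0 < depth l m z" by simp
    then obtain i where i: "bead m i < z" "z \<le> bead l i" unfolding depth_pos_iff by blast
    then have "length l \<le> i" using that bead_ge[of i m] by linarith
    then show False using i bead_beyond[of l i] bead_ge[of i m] by simp
  qed
  have hi: "depth l m z = 0" if "bead l 0 < z" for z
  proof (rule ccontr)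
    assume "depth l m z \<noteq> 0"
    then have "0 < depth l m z" by simp
    then obtain i where i: "z \<le> bead l i" unfolding depth_pos_iff by blast
    then show False using that bead_le_iff[of l i 0] sk by (auto simp: skew_partition_beads)
  qed
  define p where "p = (LEAST k. depth l m (x - int k) = 0)"
  define q where "q = (LEAST k. depth l m (x + int k) = 0)"
  have p: "depth l m (x - int p) = 0" unfolding p_def
    by (rule LeastI[of _ "nat (x + int (length l) + 1)"], rule lo) linarith
  have q: "depth l m (x + int q) = 0" unfolding q_def
    by (rule LeastI[of _ "nat (bead l 0 + 1 - x)"], rule hi) linarith
  have p_least: "0 < depth l m (x - int k)" if "k < p" for k
    using not_less_Least[OF that[unfolded p_def]] by simp
  have q_least: "0 < depth l m (x + int k)" if "k < q" for k
    using not_less_Least[OF that[unfolded q_def]] by simp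
  have p0: "0 < p" using p x by (cases p) auto
  have q0: "0 < q" using q x by (cases q) auto
  show thesis
  proof (rule that[of "x - int p" "x + int q - 1"])
    fix z assume z: "x - int p < z" "z \<le> x + int q - 1"
    show "0 < depth l m z"
    proof (cases "z \<le> x")
      case True
      then show ?thesis using p_least[of "nat (x - z)"] z by simp
    next
      case False
      then show ?thesis using q_least[of "nat (z - x)"] z by simp
    qed
  qed (use p q p0 q0 in auto)
qed

text \<open>The rim over the whole run of nonempty diagonals around \<open>B\<close> is itself a
  border strip of the shape and contains \<open>B\<close>; by maximality it equals
  \<open>B\<close>.\<close>

lemma maximal_border_strip_moves_bead:
  assumes sk: "skew_partition l m" and B: "maximal_border_strip_of l m B"
    and n: "skew_partition n m" "skew_diagram n m = skew_diagram l m - B"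
  obtains s t a where "s \<le> t" "a < bead l t" "bead l (Suc t) < a"
    "bead n = (\<lambda>i. if s \<le> i \<and> i < t then bead l (Suc i) else if i = t then a else bead l i)"
    "strip_height B = t - s" "depth l m a = 0" "depth l m (bead l s + 1) = 0"
    "\<forall>z. a < z \<longrightarrow> z \<le> bead l s \<longrightarrow> 0 < depth l m z"
    "a \<in> range (bead m)" "bead l s \<notin> range (bead m)"
proof -
  have pl: "is_partition l" and pm: "is_partition m" and ml: "\<And>i. bead m i \<le> bead l i"
    using sk by (auto simp: skew_partition_beads)
  have strip: "border_strip B" and sub: "B \<subseteq> skew_diagram l m"
    and maxi: "\<And>C. border_strip_of l m C \<Longrightarrow> \<not> B \<subset> C"
    using B by (auto simp: maximal_border_strip_of_def border_strip_of_def)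
  have B_depth: "0 < depth l m (sq_content c)" if "c \<in> B" for c
  proof -
    obtain i j where "c = (Suc i, j)" "bead m i < sq_content c" "sq_content c \<le> bead l i"
      using sub \<open>c \<in> B\<close> skew_diagramE by blast
    then show ?thesis by (auto simp: depth_pos_iff)
  qed
  obtain c0 where c0: "c0 \<in> B" using strip by (auto simp: border_strip_def)
  from depth_run[OF sk B_depth[OF c0]]
  obtain a b where ab: "a < sq_content c0" "sq_content c0 \<le> b" "depth l m a = 0" "depth l m (b + 1) = 0"
    and run: "\<And>z. a < z \<Longrightarrow> z \<le> b \<Longrightarrow> 0 < depth l m z" by blast
  have "0 < depth l m b" using run[of b] ab by simp
  \<comment> \<open>The depth falls after \<open>b\<close> and rises after \<open>a\<close>, so
    \<open>b\<close> is a bead of \<open>l\<close> alone and \<open>a\<close> a bead of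
    \<open>m\<close> alone.\<close>
  then have b: "b \<in> range (bead l)" "b \<notin> range (bead m)"
    using depth_diff[OF sk, of b] ab by (auto split: if_splits simp: of_bool_def)
  have "0 < depth l m (a + 1)" using run[of "a + 1"] ab by simp
  then have a: "a \<notin> range (bead l)" "a \<in> range (bead m)"
    using depth_diff[OF sk, of a] ab by (auto split: if_splits simp: of_bool_def)
  obtain s where s: "b = bead l s" using b by auto
  have ps: "\<And>x. a < x \<Longrightarrow> x \<le> bead l s \<Longrightarrow> 0 < depth l m x" using run s by simp
  have "a < bead l s" using ab s by simp
  from rim_strip[OF sk a(1) this ps]
  obtain n' t where n': "skew_partition n' m" and st: "s \<le> t" "a < bead l t" "bead l (Suc t) < a"
    and bn': "bead n' = (\<lambda>i. if s \<le> i \<and> i < t then bead l (Suc i) else if i = t then a else bead l i)"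
    and C: "border_strip_of l m (skew_diagram l m - skew_diagram n' m)"
    and C_eq: "skew_diagram l m - skew_diagram n' m = {c \<in> skew_diagram l m. a < sq_content c \<and>
       sq_content c \<le> bead l s \<and> bead l (fst c) < sq_content c}"
    and ht: "strip_height (skew_diagram l m - skew_diagram n' m) = t - s"
    by blast
  have conn: "connected_squares B" using strip by (simp add: border_strip_def)
  have "B \<subseteq> skew_diagram l m - skew_diagram n' m"
  proof
    fix c assume c: "c \<in> B"
    obtain i j where i: "c = (Suc i, j)" "bead m i < sq_content c" "sq_content c \<le> bead l i"
      using sub c skew_diagramE by blast
    have "a < sq_content c"
    proof (rule ccontr)
      assume "\<not> ?thesis"
      then have "a \<in> sq_content ` B"
        using connected_squares_contents[OF conn c c0, of a] ab by simp
      then show False using B_depth ab by force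
    qed
    moreover have "sq_content c \<le> bead l s"
    proof (rule ccontr)
      assume "\<not> ?thesis"
      then have "b + 1 \<in> sq_content ` B"
        using connected_squares_contents[OF conn c0 c, of "b + 1"] ab s by simp
      then show False using B_depth ab by force
    qed
    \<comment> \<open>Otherwise the diagonal successor of \<open>c\<close> is in the shape. It is
      not in \<open>B\<close>, which has one square per diagonal, so it remains in \<open>n\<close>;
      then \<open>c\<close> would remain as well.\<close>
    moreover have "bead l (Suc i) < sq_content c"
    proof (rule ccontr)
      assume not: "\<not> ?thesis"
      have "bead m (Suc i) < bead m i" using bead_decreasing[OF pm] by simp
      then obtain j' where d: "(Suc (Suc i), j') \<in> skew_diagram l m"
        "sq_content (Suc (Suc i), j') = sq_content c"
        using square_with_content[of m "Suc i" "sq_content c" l] i not by auto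
      then have "(Suc (Suc i), j') \<notin> B"
        using inj_onD[OF border_strip_content_inj[OF strip], of "(Suc (Suc i), j')" c] c i by auto
      then have "(Suc (Suc i), j') \<in> skew_diagram n m" using d n by simp
      then have "sq_content c \<le> bead n (Suc i)" using d by (simp only: mem_skew_beads)
      also have "\<dots> < bead n i" using n bead_decreasing by (simp add: skew_partition_beads)
      finally have "c \<in> skew_diagram n m" using i mem_skew_beads[of i j n m] by simp
      then show False using n c by simp
    qed
    ultimately show "c \<in> skew_diagram l m - skew_diagram n' m"
      unfolding C_eq using sub c i by auto
  qed
  then have Beq: "B = skew_diagram l m - skew_diagram n' m" using maxi[OF C] by blast
  have "skew_diagram n' m \<subseteq> skew_diagram l m"
  proof (rule skew_diagram_mono)
    show "bead n' i \<le> bead l i" for i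
      using bead_decreasing[OF pl, of i "Suc i"] st by (auto simp: bn' intro: less_imp_le)
  qed
  then have "skew_diagram n m = skew_diagram n' m" using n Beq by blast
  then have "bead n = bead n'" using skew_diagram_inj n n' by blast
  then show thesis
    using that[of s t a] st bn' ht Beq ab s ps a b by simp
qed

text \<open>Up to a shift, the pairs \<open>(bead m (p i), bead l i)\<close> are the intervals of the noncrossing
  interval set, together with a trivial pair for every common bead.\<close>

definition noncrossing_matching :: "nat list \<Rightarrow> nat list \<Rightarrow> (nat \<Rightarrow> nat) \<Rightarrow> bool" where
  "noncrossing_matching l m p \<longleftrightarrow>
     (\<forall>i. bead m (p i) \<le> bead l i) \<and>
     (\<forall>i. bead l i \<in> range (bead m) \<longrightarrow> bead m (p i) = bead l i) \<and>
     (\<forall>i x. bead m (p i) < x \<longrightarrow> x \<le> bead l i \<longrightarrow> 0 < depth l m x) \<and>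
     (\<forall>i j. \<not> (bead m (p i) < bead m (p j) \<and> bead m (p j) < bead l i \<and> bead l i < bead l j))"

section \<open>From greedy removal to a noncrossing matching\<close>

lemma length_le_if_dominated:
  assumes "is_partition n" "\<And>i. bead n i \<le> bead l i"
  shows "length n \<le> length l"
proof (rule ccontr)
  assume "\<not> ?thesis"
  then have "0 < part n (Suc (length l))" using assms(1) by (intro is_partition_part_pos) auto
  then show False using assms(2)[of "length l"] by (simp add: bead_def)
qed

text \<open>Induction along the removal. Each strip contributes one pair of positions, one bead of
  \<open>l\<close> alone, and a cycle whose sign is given by the height; the remaining shape
  supplies the other pairs.\<close>

lemma greedy_decomposition_matching:
  assumes "greedy_decomposition l m Bs" "length l \<le> N"
  shows "\<exists>p. p permutes {0..<N} \<and> sign p = (-1) ^ height_sum Bs \<and> noncrossing_matching l m p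
    \<and> finite (range (bead l) - range (bead m)) \<and> card (range (bead l) - range (bead m)) = length Bs"
  using assms
proof (induction rule: greedy_decomposition.induct)
  case (empty l m)
  have "bead l = bead m"
    by (rule skew_diagram_inj[of _ m])
      (use empty in \<open>auto simp: skew_partition_beads mem_skew_diagram skew_diagram_def\<close>)
  then have nc: "noncrossing_matching l m id"
    by (simp add: noncrossing_matching_def)
  show ?case using \<open>bead l = bead m\<close>
    by (intro exI[of _ id] conjI permutes_id nc) (simp_all add: height_sum_def sign_id)
next
  case (remove l m B n Bs)
  note sk = remove.hyps(1)
  have pl: "is_partition l" and pm: "is_partition m" and ml: "\<And>i. bead m i \<le> bead l i"
    using sk by (auto simp: skew_partition_beads)
  obtain s t a where st: "s \<le> t" "a < bead l t" "bead l (Suc t) < a"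
    and bn: "bead n = (\<lambda>i. if s \<le> i \<and> i < t then bead l (Suc i) else if i = t then a else bead l i)"
    and ht: "strip_height B = t - s" and da: "depth l m a = 0" and db: "depth l m (bead l s + 1) = 0"
    and run: "\<forall>z. a < z \<longrightarrow> z \<le> bead l s \<longrightarrow> 0 < depth l m z"
    and a: "a \<in> range (bead m)" and b: "bead l s \<notin> range (bead m)"
    by (rule maximal_border_strip_moves_bead[OF sk remove.hyps(2-4)]) (rule that)
  have "t < length l"
    using st bead_beyond[of l t] bead_beyond[of l "Suc t"] by (cases "t < length l") auto
  then have tN: "t < N" using remove.prems by simp
  have nl: "bead n i \<le> bead l i" for i
    using bead_decreasing[OF pl, of i "Suc i"] st by (auto simp: bn intro: less_imp_le)
  have "length n \<le> N"
    using length_le_if_dominated[of n l] nl remove.hyps(3) remove.prems by (simp add: skew_partition_beads)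
  then obtain p where p: "p permutes {0..<N}" and sp: "sign p = (-1) ^ height_sum Bs"
    and pn: "noncrossing_matching n m p" and fin: "finite (range (bead n) - range (bead m))"
    and card: "card (range (bead n) - range (bead m)) = length Bs"
    using remove.IH by blast
  \<comment> \<open>The cycle that sorts the beads again: \<open>bead n \<circ> q\<close> is
    \<open>bead l\<close> with the bead of row \<open>s\<close> put at \<open>a\<close>. It involves
    t - s + 1 rows, hence its sign.\<close>
  define q :: "nat \<Rightarrow> nat" where "q = permutation_insert s t id"
  have q_eq: "q i = (if i = s then t else if s < i \<and> i \<le> t then i - 1 else i)" for i
    using st(1) by (auto simp: q_def permutation_insert_expand)
  have N: "Suc (N - 1) = N" using tN by simp
  have qp: "q permutes {0..<N}"
    using permutation_insert_permutes[of id "N - 1" s t] st(1) tN unfolding q_def N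
    by (simp add: permutes_id)
  have sq: "sign q = (-1) ^ (t - s)"
  proof -
    have "sign q = (-1) ^ (s + t) * sign (id :: nat \<Rightarrow> nat)"
      using signof_permutation_insert[of id "N - 1" s t, where 'a = int] st(1) tN
      unfolding q_def by (simp add: permutes_id)
    also have "(-1::int) ^ (s + t) = (-1) ^ (t - s)"
      using st(1) by (auto simp: minus_one_power_iff)
    finally show ?thesis by (simp add: sign_id)
  qed
  have nq: "bead n (q i) = (if i = s then a else bead l i)" for i
    using st(1) by (auto simp: bn q_eq)
  have pn1: "bead m (p i) \<le> bead n i"
    and pn2: "bead n i \<in> range (bead m) \<Longrightarrow> bead m (p i) = bead n i"
    and pn3: "bead m (p i) < x \<Longrightarrow> x \<le> bead n i \<Longrightarrow> 0 < depth n m x"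
    and pn4: "\<not> (bead m (p i) < bead m (p j) \<and> bead m (p j) < bead n i \<and> bead n i < bead n j)"
    for i j x using pn unfolding noncrossing_matching_def by blast+
  have depth_le: "0 < depth l m x" if "0 < depth n m x" for x
    using that nl by (auto simp: depth_pos_iff intro: order_trans)
  define pq where "pq = p \<circ> q"
  \<comment> \<open>In \<open>n\<close> the position \<open>a\<close> is a common bead and is
    matched to itself; for \<open>l\<close> this pair becomes the interval from \<open>a\<close> to
    \<open>bead l s\<close>.\<close>
  have pq_s: "bead m (pq s) = a"
    using pn2[of "q s"] a nq[of s] by (simp add: pq_def)
  have pq1: "bead m (pq i) \<le> bead l i" for i
    using pn1[of "q i"] nq[of i] st bead_le_iff[OF pl, of t s] by (auto simp: pq_def split: if_splits)
  have pq2: "bead m (pq i) = bead l i" if "bead l i \<in> range (bead m)" for i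
    using pn2[of "q i"] nq[of i] b that by (auto simp: pq_def split: if_splits)
  have pq3': "0 < depth n m x" if "i \<noteq> s" "bead m (pq i) < x" "x \<le> bead l i" for i x
    using pn3[of "q i" x] nq[of i] that by (simp add: pq_def)
  have pq3: "0 < depth l m x" if "bead m (pq i) < x" "x \<le> bead l i" for i x
    using pq3'[of i x] depth_le[of x] run pq_s that by (cases "i = s") auto
  \<comment> \<open>The diagonals at \<open>a\<close> and \<open>bead l s + 1\<close> are empty, so
    no other interval runs across them: it lies to the right, to the left, or strictly inside the
    new one.\<close>
  have away: "bead l s < bead m (pq i) \<or> bead l i < a \<or> (a < bead m (pq i) \<and> bead l i < bead l s)"
    if "i \<noteq> s" "bead m (pq i) < bead l i" for i
  proof -
    have 1: "\<not> (bead m (pq i) < a \<and> a \<le> bead l i)" using pq3[of i a] da by auto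
    have 2: "\<not> (bead m (pq i) < bead l s + 1 \<and> bead l s + 1 \<le> bead l i)"
      using pq3[of i "bead l s + 1"] db by auto
    have 3: "bead l i \<noteq> bead l s" using bead_eq_iff[OF pl] that by simp
    have 4: "bead m (pq i) \<noteq> a"
    proof
      assume "bead m (pq i) = a"
      then have "pq i = pq s" using pq_s bead_eq_iff[OF pm] by metis
      then show False using injD[OF permutes_inj[OF permutes_compose[OF qp p]], of i s] that by (simp add: pq_def)
    qed
    show ?thesis using 1 2 3 4 by linarith
  qed
  have pq4: "\<not> (bead m (pq i) < bead m (pq j) \<and> bead m (pq j) < bead l i \<and> bead l i < bead l j)" for i j
  proof
    assume *: "bead m (pq i) < bead m (pq j) \<and> bead m (pq j) < bead l i \<and> bead l i < bead l j"
    consider "i = s" "j \<noteq> s" | "i \<noteq> s" "j = s" | "i \<noteq> s" "j \<noteq> s" using * by blast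
    then show False
    proof cases
      case 1
      then show False using away[of j] * pq_s by auto
    next
      case 2
      then show False using away[of i] * pq_s by auto
    next
      case 3
      then show False using pn4[of "q i" "q j"] nq[of i] nq[of j] * by (simp add: pq_def)
    qed
  qed
  have "noncrossing_matching l m pq"
    unfolding noncrossing_matching_def using pq1 pq2 pq3 pq4 by blast
  moreover have "pq permutes {0..<N}" unfolding pq_def by (rule permutes_compose[OF qp p])
  moreover have "sign pq = (-1) ^ height_sum (B # Bs)"
  proof -
    have "sign pq = sign p * sign q" unfolding pq_def
      by (rule sign_compose) (use p qp permutation_permutes in blast)+
    then show ?thesis by (simp add: sp sq ht height_sum_def power_add mult.commute)
  qed
  moreover have "range (bead l) - range (bead m) = insert (bead l s) (range (bead n) - range (bead m))"
    and "bead l s \<notin> range (bead n) - range (bead m)"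
  proof -
    have "range (bead n) = range (bead n \<circ> q)"
      using permutes_surj[OF qp] by (metis image_comp)
    also have "bead n \<circ> q = (bead l)(s := a)" using nq by auto
    also have "range \<dots> = insert a (range (bead l) - {bead l s})"
      using bead_eq_iff[OF pl] by (auto simp: image_iff)
    finally have r: "range (bead n) = insert a (range (bead l) - {bead l s})" .
    show "range (bead l) - range (bead m) = insert (bead l s) (range (bead n) - range (bead m))"
      using r a b by auto
    show "bead l s \<notin> range (bead n) - range (bead m)" using r a b by auto
  qed
  ultimately show ?case using fin card
    by (intro exI[of _ pq]) auto
qed

section \<open>The rank as the number of beads of the outer partition alone\<close>

lemma greedy_decomposition_partition:
  assumes "greedy_decomposition l m Bs"
  shows "partition_on (skew_diagram l m) (set Bs) \<and> distinct Bs \<and> (\<forall>B\<in>set Bs. border_strip B)"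
  using assms
proof (induction rule: greedy_decomposition.induct)
  case (empty l m)
  then show ?case by (simp add: partition_on_def)
next
  case (remove l m B n Bs)
  then have B: "border_strip B" "B \<subseteq> skew_diagram l m" "B \<noteq> {}"
    by (auto simp: maximal_border_strip_of_def border_strip_of_def border_strip_def)
  have IH: "partition_on (skew_diagram l m - B) (set Bs)" "distinct Bs" "\<forall>B\<in>set Bs. border_strip B"
    using remove by auto
  have "C \<inter> B = {}" if "C \<in> set Bs" for C using IH(1) that by (auto simp: partition_on_def)
  moreover have "\<Union> (set Bs) = skew_diagram l m - B" using IH(1) by (simp add: partition_on_def)
  ultimately have "partition_on (skew_diagram l m) (set (B # Bs))"
    using IH B by (auto simp: partition_on_def disjoint_def)
  moreover have "B \<notin> set Bs" using \<open>\<And>C. C \<in> set Bs \<Longrightarrow> C \<inter> B = {}\<close> B by blast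
  ultimately show ?case using IH B by simp
qed

lemma finite_skew_diagram [simp]: "finite (skew_diagram l m)"
  using skew_diagram_eq_region[of l "length l" m] by simp

text \<open>A bead of \<open>l\<close> that is not a bead of \<open>m\<close> marks a content above which the diagonals get
  shorter, so some strip must end there.\<close>

lemma card_beads_le_card_strips:
  assumes sk: "skew_partition l m" and P: "partition_on (skew_diagram l m) P"
    and strips: "\<And>B. B \<in> P \<Longrightarrow> border_strip B"
  shows "card (range (bead l) - range (bead m)) \<le> card P"
proof -
  have fP: "finite P" using P finite_skew_diagram finite_UnionD unfolding partition_on_def by metis
  \<comment> \<open>A strip has at most one square on each diagonal, so the depth counts the strips
    that meet the diagonal.\<close>
  have depth_eq: "depth l m x = card {B \<in> P. x \<in> sq_content ` B}" for x
  proof -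
    have "{c \<in> skew_diagram l m. sq_content c = x} = (\<Union>B\<in>P. {c \<in> B. sq_content c = x})"
      using P by (auto simp: partition_on_def)
    then have "depth l m x = card (\<Union>B\<in>P. {c \<in> B. sq_content c = x})"
      using card_sq_content[of l m x] by simp
    also have "\<dots> = (\<Sum>B\<in>P. card {c \<in> B. sq_content c = x})"
    proof (rule card_UN_disjoint[OF fP])
      show "\<forall>B\<in>P. finite {c \<in> B. sq_content c = x}"
        using P finite_skew_diagram[of l m] by (auto simp: partition_on_def intro: finite_subset)
      show "\<forall>B\<in>P. \<forall>C\<in>P. B \<noteq> C \<longrightarrow> {c \<in> B. sq_content c = x} \<inter> {c \<in> C. sq_content c = x} = {}"
        using P by (auto simp: partition_on_def disjoint_def)
    qed
    also have "\<dots> = (\<Sum>B\<in>P. if x \<in> sq_content ` B then 1 else 0)"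
    proof (intro sum.cong refl)
      fix B assume "B \<in> P"
      note inj = border_strip_content_inj[OF strips[OF this]]
      show "card {c \<in> B. sq_content c = x} = (if x \<in> sq_content ` B then 1 else 0)"
      proof (cases "x \<in> sq_content ` B")
        case True
        then obtain c where c: "c \<in> B" "sq_content c = x" by auto
        have "d = c" if "d \<in> B" "sq_content d = x" for d
          using inj_onD[OF inj, of d c] that c by simp
        then have "{c \<in> B. sq_content c = x} = {c}" using c by blast
        then show ?thesis using True by simp
      next
        case False
        then have "{c \<in> B. sq_content c = x} = {}" by blast
        then show ?thesis using False by (simp only: card.empty if_False)
      qed
    qed
    also have "\<dots> = card {B \<in> P. x \<in> sq_content ` B}"
      using fP by (simp add: sum.If_cases Int_def)
    finally show ?thesis .
  qed
  have "\<exists>B\<in>P. v \<in> sq_content ` B \<and> v + 1 \<notin> sq_content ` B" if "v \<in> range (bead l) - range (bead m)" for v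
  proof (rule ccontr)
    assume "\<not> ?thesis"
    then have "{B \<in> P. v \<in> sq_content ` B} \<subseteq> {B \<in> P. v + 1 \<in> sq_content ` B}" by auto
    then have "depth l m v \<le> depth l m (v + 1)"
      unfolding depth_eq using fP by (intro card_mono) auto
    then show False using depth_diff[OF sk, of v] that by simp
  qed
  then obtain f where f: "f v \<in> P \<and> v \<in> sq_content ` f v \<and> v + 1 \<notin> sq_content ` f v"
    if "v \<in> range (bead l) - range (bead m)" for v by metis
  \<comment> \<open>The contents of a strip form an interval, so it cannot end at \<open>v\<close>
    and still reach \<open>w\<close>.\<close>
  have less: "f v \<noteq> f w" if vw: "v \<in> range (bead l) - range (bead m)" "w \<in> range (bead l) - range (bead m)" "v < w" for v w
  proof
    assume "f v = f w"
    moreover obtain c where "c \<in> f v" "v = sq_content c" using f[OF vw(1)] by blast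
    moreover obtain d where "d \<in> f w" "w = sq_content d" using f[OF vw(2)] by blast
    ultimately have "v + 1 \<in> sq_content ` f v"
      using connected_squares_contents[of "f v" c d "v + 1"] strips[of "f v"] f[OF vw(1)] vw(3)
      by (simp add: border_strip_def)
    then show False using f[OF vw(1)] by simp
  qed
  have "inj_on f (range (bead l) - range (bead m))"
  proof (rule inj_onI)
    fix v w assume "v \<in> range (bead l) - range (bead m)" "w \<in> range (bead l) - range (bead m)" "f v = f w"
    then show "v = w" using less[of v w] less[of w v] by (cases v w rule: linorder_cases) auto
  qed
  then show ?thesis using f fP by (intro card_inj_on_le[of f]) auto
qed

text \<open>A greedy decomposition has as many strips as there are such beads, so it attains the
  lower bound valid for all decompositions.\<close>

lemma skew_rank_eq_card_beads:
  assumes "skew_partition l m" "greedy_decomposition l m Bs"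
  shows "skew_rank l m = card (range (bead l) - range (bead m))"
proof -
  have "card (range (bead l) - range (bead m)) = card (set Bs)"
    using greedy_decomposition_matching[OF assms(2) order_refl] greedy_decomposition_partition[OF assms(2)]
    by (auto simp: distinct_card)
  then show ?thesis unfolding skew_rank_def
    using greedy_decomposition_partition[OF assms(2)] card_beads_le_card_strips[OF assms(1)]
    by (intro Least_equality) auto
qed

section \<open>Snakes\<close>

text \<open>A vertical edge has the position of the bead of its row, and the positions increase by one
  along the path.\<close>

fun edge_pos :: "edge \<Rightarrow> int" where
  "edge_pos (Horiz i j) = int j - int i - 1"
| "edge_pos (Vert i j) = int j - int i"

fun boundary_edge :: "nat list \<Rightarrow> edge \<Rightarrow> bool" where
  "boundary_edge l (Horiz i j) \<longleftrightarrow> 1 \<le> i \<and> part l (i + 1) < j \<and> j \<le> part l i"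
| "boundary_edge l (Vert i j) \<longleftrightarrow> 1 \<le> i \<and> j = part l i"

text \<open>A nonempty snake consists of all squares on the two adjacent diagonals on either side of
  its edge; since the edge lies on the boundary of \<open>l\<close>, neither diagonal continues
  beyond it.\<close>

lemma card_snake:
  assumes sk: "skew_partition l m" and e: "boundary_edge l e" and ne: "snake l m e \<noteq> {}"
  shows "card (snake l m e) = depth l m (edge_pos e) + depth l m (edge_pos e + 1)"
proof -
  have pl: "part l i' \<le> part l i" if "1 \<le> i" "i \<le> i'" for i i'
    using sk that by (auto simp: skew_partition_iff is_partition_part_mono)
  have bound: "d \<le> part l c" "1 \<le> c" if "(c, d) \<in> skew_diagram l m" for c d
    using that by (auto simp: mem_skew_diagram)
  have "snake l m e = {c \<in> skew_diagram l m. sq_content c = edge_pos e} \<union>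
      {c \<in> skew_diagram l m. sq_content c = edge_pos e + 1}"
  proof (cases e)
    case (Horiz i j)
    have ij: "(i, j) \<in> skew_diagram l m" using ne Horiz by (auto split: if_splits)
    have "(\<exists>n. (c + n, d + n) = (i, j) \<or> (c + n, d + n + 1) = (i, j)) \<longleftrightarrow>
        int d - int c = int j - int i - 1 \<or> int d - int c = int j - int i" (is "?L \<longleftrightarrow> ?R")
      if cd: "(c, d) \<in> skew_diagram l m" for c d
    proof
      assume ?R
      have "c \<le> i"
      proof (rule ccontr)
        assume "\<not> c \<le> i"
        then have "part l c \<le> part l (i + 1)" using pl by simp
        then show False using \<open>?R\<close> bound[OF cd] e Horiz \<open>\<not> c \<le> i\<close> by auto
      qed
      then show ?L using \<open>?R\<close> by (intro exI[of _ "i - c"]) auto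
    qed auto
    then show ?thesis using ij Horiz by auto
  next
    case (Vert i j)
    have ij: "(i, j) \<in> skew_diagram l m" using ne Vert by (auto split: if_splits)
    have "(\<exists>n. (c + n, d + n) = (i, j) \<or> (c + n + 1, d + n) = (i, j)) \<longleftrightarrow>
        int d - int c = int j - int i \<or> int d - int c = int j - int i + 1" (is "?L \<longleftrightarrow> ?R")
      if cd: "(c, d) \<in> skew_diagram l m" for c d
    proof
      assume R: ?R
      have d: "d \<le> j"
      proof (rule ccontr)
        assume "\<not> d \<le> j"
        then have "i \<le> c" using R by auto
        then have "part l c \<le> part l i" using pl[of i c] e Vert by simp
        then show False using bound[OF cd] e Vert \<open>\<not> d \<le> j\<close> by auto
      qed
      then show ?L using R by (intro exI[of _ "j - d"]) auto
    qed auto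
    then show ?thesis using ij Vert by auto
  qed
  then have "card (snake l m e) = card {c \<in> skew_diagram l m. sq_content c = edge_pos e} +
      card {c \<in> skew_diagram l m. sq_content c = edge_pos e + 1}"
    by (simp only:) (rule card_Un_disjoint, auto)
  then show ?thesis by (simp only: card_sq_content)
qed

text \<open>Even length means an odd number of squares, so the depth changes at the edge and exactly
  one of \<open>l\<close> and \<open>m\<close> has a bead there. A vertical edge is at a bead of
  \<open>l\<close>; a horizontal one lies strictly between beads of consecutive rows.\<close>

lemma snake_symbol_bead:
  assumes sk: "skew_partition l m" and e: "boundary_edge l e"
  shows "snake_symbol_of l m e = LSnake n \<Longrightarrow> edge_pos e \<in> range (bead m) - range (bead l)"
    and "snake_symbol_of l m e = RSnake n \<Longrightarrow> edge_pos e \<in> range (bead l) - range (bead m)"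
proof -
  have pl: "is_partition l" using sk by (simp add: skew_partition_iff)
  have xor: "(edge_pos e \<in> range (bead l)) \<noteq> (edge_pos e \<in> range (bead m))"
    if "snake_symbol_of l m e \<noteq> OSnake"
  proof -
    have "even (snake_length l m e)"
    proof (rule ccontr)
      assume "odd (snake_length l m e)"
      then show False using that by (simp add: snake_symbol_of_def)
    qed
    then have odd: "odd (card (snake l m e))" by (simp add: snake_length_def)
    then have "snake l m e \<noteq> {}" by auto
    then have "odd (depth l m (edge_pos e) + depth l m (edge_pos e + 1))"
      using card_snake[OF sk e] odd by simp
    then have "odd (int (depth l m (edge_pos e)) - int (depth l m (edge_pos e + 1)))" by simp
    then show ?thesis unfolding depth_diff[OF sk] by (auto simp: of_bool_def split: if_splits)
  qed
  show "edge_pos e \<in> range (bead m) - range (bead l)" if L: "snake_symbol_of l m e = LSnake n"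
  proof -
    obtain i j where ij: "e = Horiz i j"
      using L by (cases e) (auto simp: snake_symbol_of_def split: if_splits)
    obtain k where k: "i = Suc k" using e ij by (cases i) auto
    have "bead l i < edge_pos e" "edge_pos e < bead l k"
      using e ij k by (auto simp: bead_def)
    then have "edge_pos e \<noteq> bead l h" for h
      using bead_le_iff[OF pl, of h i] bead_le_iff[OF pl, of k h] k by (cases "h \<le> k") auto
    then show ?thesis using xor L by auto
  qed
  show "edge_pos e \<in> range (bead l) - range (bead m)" if R: "snake_symbol_of l m e = RSnake n"
  proof -
    obtain i j where ij: "e = Vert i j"
      using R by (cases e) (auto simp: snake_symbol_of_def split: if_splits)
    obtain k where k: "i = Suc k" using e ij by (cases i) auto
    have "edge_pos e = bead l k" using e ij k by (auto simp: bead_def)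
    then show ?thesis using xor R by auto
  qed
qed

section \<open>Positions along the boundary path\<close>

lemma row_edge_pos:
  assumes "st \<le> part l i"
  shows "map edge_pos (map (Horiz i) [st + 1..<part l i + 1] @ [Vert i (part l i)]) =
    [int st - int i..int (part l i) - int i]"
  by (rule nth_equalityI) (use assms in \<open>auto simp: nth_append\<close>)

text \<open>Each row of the path covers an interval of positions that starts right after the end of
  the interval of the row below, so the intervals concatenate.\<close>

lemma boundary_path_edges:
  assumes sk: "skew_partition l m"
  obtains off where "map edge_pos (boundary_path l m) = map (\<lambda>k. off + int (Suc k)) [0..<length (boundary_path l m)]"
    "\<And>e. e \<in> set (boundary_path l m) \<Longrightarrow> boundary_edge l e"
proof (cases "skew_diagram l m = {}")
  case True
  then show thesis using that by (simp add: boundary_path_def)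
next
  case False
  define a where "a = Min (fst ` skew_diagram l m)"
  define b where "b = Max (fst ` skew_diagram l m)"
  have pl: "part l i' \<le> part l i" "part m i' \<le> part m i" "part m i \<le> part l i"
    if "1 \<le> i" "i \<le> i'" for i i'
    using sk that by (auto simp: skew_partition_iff is_partition_part_mono)
  have "a \<in> fst ` skew_diagram l m" "b \<in> fst ` skew_diagram l m"
    unfolding a_def b_def using False by (intro Min_in Max_in; simp)+
  then have a1: "1 \<le> a" and b1: "1 \<le> b" and mb: "part m b \<le> part l b" and ab: "a \<le> b"
    using False by (auto simp: mem_skew_diagram a_def)
  \<comment> \<open>Row \<open>b + 1\<close> is empty in the skew shape. Hence the bottom row of the
    path, which starts after column \<open>part m b\<close>, uses only edges on the boundary of
    \<open>l\<close>.\<close>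
  have lb: "part l (b + 1) \<le> part m b"
  proof -
    have "(b + 1, part l (b + 1)) \<notin> skew_diagram l m"
    proof
      assume "(b + 1, part l (b + 1)) \<in> skew_diagram l m"
      then have "b + 1 \<in> fst ` skew_diagram l m" by force
      then have "b + 1 \<le> b" unfolding b_def by (intro Max_ge) auto
      then show False by simp
    qed
    then have "part l (b + 1) \<le> part m (b + 1)" by (simp add: mem_skew_diagram)
    also have "\<dots> \<le> part m b" using pl b1 by simp
    finally show ?thesis .
  qed
  define row where "row i = map (Horiz i) [(if i = b then part m b else part l (i + 1)) + 1 ..< part l i + 1]
      @ [Vert i (part l i)]" for i
  have path: "boundary_path l m = concat (map row (rev [a..<b + 1]))"
    using False unfolding boundary_path_def row_def a_def b_def by (simp add: Let_def)
  have row_pos: "map edge_pos (row i) =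
      [int (if i = b then part m b else part l (i + 1)) - int i..int (part l i) - int i]"
    if "1 \<le> i" for i unfolding row_def using pl[of i "i + 1"] mb that by (intro row_edge_pos) auto
  have pos: "map edge_pos (concat (map row (rev [c..<b + 1]))) = [int (part m b) - int b..int (part l c) - int c]"
    if "1 \<le> c" "c \<le> b" for c
    using that(2,1)
  proof (induction rule: inc_induct)
    case base
    have "[b..<b + 1] = [b]" by simp
    then show ?case using row_pos[of b] b1 by simp
  next
    case (step c)
    have "[c..<b + 1] = c # [Suc c..<b + 1]" using step by (simp add: upt_conv_Cons)
    then have "map edge_pos (concat (map row (rev [c..<b + 1]))) =
        map edge_pos (concat (map row (rev [Suc c..<b + 1]))) @ map edge_pos (row c)" by simp
    also have "\<dots> = [int (part m b) - int b..int (part l (Suc c)) - int (Suc c)] @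
        [int (part l (Suc c)) - int c..int (part l c) - int c]"
      using step row_pos[of c] by simp
    also have "\<dots> = [int (part m b) - int b..int (part l c) - int c]"
    proof -
      have "part m b \<le> part l (Suc c)" using pl[of "Suc c" b] pl(3)[of b b] b1 step by simp
      moreover have "part l (Suc c) \<le> part l c" using pl[of c "Suc c"] step by simp
      ultimately show ?thesis
        using upto_split1[of "int (part m b) - int b" "int (part l (Suc c)) - int c" "int (part l c) - int c"] step
        by (simp add: algebra_simps)
    qed
    finally show ?case .
  qed
  show thesis
  proof (rule that)
    have eq: "map edge_pos (boundary_path l m) = [int (part m b) - int b..int (part l a) - int a]"
      unfolding path by (rule pos[OF a1 ab])
    then have len: "length (boundary_path l m) = nat (int (part l a) - int a - (int (part m b) - int b) + 1)"
      by (metis length_map length_upto)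
    show "map edge_pos (boundary_path l m) =
        map (\<lambda>k. (int (part m b) - int b - 1) + int (Suc k)) [0..<length (boundary_path l m)]"
      unfolding eq len by (rule nth_equalityI) auto
    fix e assume "e \<in> set (boundary_path l m)"
    then obtain i where i: "a \<le> i" "i \<le> b" "e \<in> set (row i)" unfolding path by (auto simp: less_Suc_eq_le)
    then show "boundary_edge l e" using a1 lb unfolding row_def by (auto split: if_splits)
  qed
qed

lemma snake_sequence_beads:
  assumes sk: "skew_partition l m"
  obtains off where "\<And>u n. 1 \<le> u \<Longrightarrow> u \<le> length (snake_sequence l m) \<Longrightarrow>
      snake_sequence l m ! (u - 1) = LSnake n \<Longrightarrow> off + int u \<in> range (bead m) - range (bead l)"
    "\<And>u n. 1 \<le> u \<Longrightarrow> u \<le> length (snake_sequence l m) \<Longrightarrow>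
      snake_sequence l m ! (u - 1) = RSnake n \<Longrightarrow> off + int u \<in> range (bead l) - range (bead m)"
proof -
  obtain off where pos: "map edge_pos (boundary_path l m) = map (\<lambda>k. off + int (Suc k)) [0..<length (boundary_path l m)]"
    and edge: "\<And>e. e \<in> set (boundary_path l m) \<Longrightarrow> boundary_edge l e"
    using boundary_path_edges[OF sk] by blast
  have *: "edge_pos (boundary_path l m ! (u - 1)) = off + int u \<and> boundary_edge l (boundary_path l m ! (u - 1))
      \<and> snake_sequence l m ! (u - 1) = snake_symbol_of l m (boundary_path l m ! (u - 1))"
    if u: "1 \<le> u" "u \<le> length (snake_sequence l m)" for u
  proof -
    have k: "u - 1 < length (boundary_path l m)" using u by (simp add: snake_sequence_def)
    have "edge_pos (boundary_path l m ! (u - 1)) = map edge_pos (boundary_path l m) ! (u - 1)"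
      using k by simp
    also have "\<dots> = off + int (Suc (u - 1))" unfolding pos using k by simp
    finally show ?thesis using u edge[OF nth_mem[OF k]] k by (simp add: snake_sequence_def)
  qed
  show thesis
  proof (rule that)
    fix u n assume u: "1 \<le> u" "u \<le> length (snake_sequence l m)"
    show "off + int u \<in> range (bead m) - range (bead l)" if "snake_sequence l m ! (u - 1) = LSnake n"
      using *[OF u] snake_symbol_bead(1)[OF sk, of "boundary_path l m ! (u - 1)" n] that by metis
    show "off + int u \<in> range (bead l) - range (bead m)" if "snake_sequence l m ! (u - 1) = RSnake n"
      using *[OF u] snake_symbol_bead(2)[OF sk, of "boundary_path l m ! (u - 1)" n] that by metis
  qed
qed

section \<open>Noncrossing matchings and principal minors\<close>

text \<open>Call first components openings and second ones closings. If \<open>J\<close> took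
  \<open>u\<close> beyond \<open>v\<close>, then \<open>I\<close> would inject the openings between
  \<open>u\<close> and \<open>v\<close> into the closings there, while \<open>J\<close> would inject
  these closings together with \<open>v\<close> into the openings, contradicting the count.\<close>

lemma noncrossing_partner_le:
  fixes I J :: "('a::linorder \<times> 'a) set"
  assumes fin: "finite I"
    and inj: "inj_on snd I" "inj_on fst J"
    and eq: "fst ` I = fst ` J" "snd ` I = snd ` J"
    and less: "\<And>u v. (u, v) \<in> I \<Longrightarrow> u < v" "\<And>u v. (u, v) \<in> J \<Longrightarrow> u < v"
    and nc: "\<And>u v u' v'. (u, v) \<in> I \<Longrightarrow> (u', v') \<in> I \<Longrightarrow> \<not> (u < u' \<and> u' < v \<and> v < v')"
      "\<And>u v u' v'. (u, v) \<in> J \<Longrightarrow> (u', v') \<in> J \<Longrightarrow> \<not> (u < u' \<and> u' < v \<and> v < v')"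
    and uv: "(u, v) \<in> I" "(u, v') \<in> J"
  shows "v' \<le> v"
proof (rule ccontr)
  assume "\<not> v' \<le> v"
  then have vv: "v < v'" by simp
  define U where "U = {x \<in> fst ` I. u < x \<and> x < v}"
  define V where "V = {y \<in> snd ` I. u < y \<and> y < v}"
  have fU: "finite U" and fV: "finite V" using fin by (auto simp: U_def V_def)
  have "\<exists>y. (x, y) \<in> I \<and> y \<in> V" if xU: "x \<in> U" for x
  proof -
    obtain y where y: "(x, y) \<in> I" using xU by (auto simp: U_def)
    have "y \<noteq> v" using inj_onD[OF inj(1), of "(x, y)" "(u, v)"] y uv xU by (auto simp: U_def)
    moreover have "\<not> v < y" using nc(1)[OF uv(1) y] xU by (auto simp: U_def)
    ultimately have "y < v" by simp
    moreover have "u < y" using xU less(1)[OF y] by (auto simp: U_def)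
    moreover have "y \<in> snd ` I" using y by force
    ultimately show ?thesis using y by (auto simp: V_def)
  qed
  then obtain f where f: "\<And>x. x \<in> U \<Longrightarrow> (x, f x) \<in> I \<and> f x \<in> V" by metis
  have "inj_on f U"
  proof (rule inj_onI)
    fix x y assume "x \<in> U" "y \<in> U" "f x = f y"
    then show "x = y" using f[of x] f[of y] inj_onD[OF inj(1), of "(x, f x)" "(y, f y)"] by auto
  qed
  then have UV: "card U \<le> card V" using f fV by (intro card_inj_on_le) auto
  have "\<exists>x. (x, y) \<in> J \<and> x \<in> U" if yV: "y \<in> insert v V" for y
  proof -
    have y: "y \<in> snd ` I" "u < y" "y \<le> v" using yV uv less(1)[OF uv(1)] by (force simp: V_def)+
    then have "y \<in> snd ` J" using eq by simp
    then obtain x where x: "(x, y) \<in> J" by auto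
    have "x \<noteq> u" using inj_onD[OF inj(2), of "(x, y)" "(u, v')"] x uv y vv by auto
    moreover have "\<not> x < u" using nc(2)[OF x uv(2)] y vv by auto
    ultimately have "u < x" by simp
    moreover have "x < v" using less(2)[OF x] y by simp
    moreover have "x \<in> fst ` I" unfolding eq(1) using x by force
    ultimately show ?thesis using x by (auto simp: U_def)
  qed
  then obtain g where g: "\<And>y. y \<in> insert v V \<Longrightarrow> (g y, y) \<in> J \<and> g y \<in> U" by metis
  have "inj_on g (insert v V)"
  proof (rule inj_onI)
    fix x y assume "x \<in> insert v V" "y \<in> insert v V" "g x = g y"
    then show "x = y" using g[of x] g[of y] inj_onD[OF inj(2), of "(g x, x)" "(g y, y)"] by auto
  qed
  then have "card (insert v V) \<le> card U" using g fU by (intro card_inj_on_le[of g]) auto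
  moreover have "card (insert v V) = Suc (card V)" using fV by (simp add: V_def)
  ultimately show False using UV by simp
qed

lemma noncrossing_unique:
  fixes I J :: "('a::linorder \<times> 'a) set"
  assumes fin: "finite I" "finite J"
    and inj: "inj_on fst I" "inj_on fst J" "inj_on snd I" "inj_on snd J"
    and eq: "fst ` I = fst ` J" "snd ` I = snd ` J"
    and less: "\<And>u v. (u, v) \<in> I \<Longrightarrow> u < v" "\<And>u v. (u, v) \<in> J \<Longrightarrow> u < v"
    and nc: "\<And>u v u' v'. (u, v) \<in> I \<Longrightarrow> (u', v') \<in> I \<Longrightarrow> \<not> (u < u' \<and> u' < v \<and> v < v')"
      "\<And>u v u' v'. (u, v) \<in> J \<Longrightarrow> (u', v') \<in> J \<Longrightarrow> \<not> (u < u' \<and> u' < v \<and> v < v')"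
  shows "I = J"
proof -
  have partner: "v = v'" if "(u, v) \<in> I" "(u, v') \<in> J" for u v v'
  proof (rule antisym)
    show "v' \<le> v"
      by (rule noncrossing_partner_le[of I J u]) (fact fin inj eq less nc that)+
    show "v \<le> v'"
      by (rule noncrossing_partner_le[of J I u])
        (fact fin inj eq[symmetric] less nc that)+
  qed
  show ?thesis
  proof (intro equalityI subrelI)
    fix u v assume uv: "(u, v) \<in> I"
    then have "u \<in> fst ` J" unfolding eq(1)[symmetric] by force
    then obtain v' where "(u, v') \<in> J" by auto
    then show "(u, v) \<in> J" using partner[OF uv] by simp
  next
    fix u v assume uv: "(u, v) \<in> J"
    then have "u \<in> fst ` I" unfolding eq(1) by force
    then obtain v' where "(u, v') \<in> I" by auto
    then show "(u, v) \<in> I" using partner[OF _ uv] by simp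
  qed
qed

section \<open>Scaling, column permutations and principal minors\<close>

lemma det_scale_rows:
  "det (mat n n (\<lambda>(i, j). c i * g i j)) = (\<Prod>i\<in>{0..<n}. c i) * det (mat n n (\<lambda>(i, j). g i j))"
  unfolding det_mat_fun by (simp add: prod.distrib sum_distrib_left algebra_simps)

lemma det_mat_permute_columns:
  fixes g :: "nat \<Rightarrow> nat \<Rightarrow> 'a::comm_ring_1"
  assumes p: "p permutes {0..<n}"
  shows "det (mat n n (\<lambda>(i, j). g i (p j))) = signof p * det (mat n n (\<lambda>(i, j). g i j))"
proof -
  let ?A = "mat n n (\<lambda>(i, j). g j i)"
  have t: "det (mat n n (\<lambda>(i, j). h j i)) = det (mat n n (\<lambda>(i, j). h i j))" for h :: "nat \<Rightarrow> nat \<Rightarrow> 'a"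
  proof -
    have "mat n n (\<lambda>(i, j). h j i) = transpose_mat (mat n n (\<lambda>(i, j). h i j))"
      by (rule eq_matI) auto
    then show ?thesis by (simp add: det_transpose[of _ n])
  qed
  have "det (mat n n (\<lambda>(i, j). g i (p j))) = det (mat n n (\<lambda>(i, j). g j (p i)))"
    using t[of "\<lambda>i j. g i (p j)"] by simp
  also have "mat n n (\<lambda>(i, j). g j (p i)) = mat n n (\<lambda>(i, j). ?A $$ (p i, j))"
    using permutes_in_image[OF p] by (intro eq_matI) auto
  also have "det \<dots> = signof p * det ?A" by (rule det_permute_rows[OF _ p]) simp
  finally show ?thesis using t[of g] by simp
qed

text \<open>Rows outside \<open>A\<close> are unit vectors, so only permutations that fix all
  indices outside \<open>A\<close> contribute. Transporting them along \<open>f\<close> preserves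
  signs.\<close>

lemma det_principal_minor:
  fixes g :: "nat \<Rightarrow> nat \<Rightarrow> 'a::comm_ring_1"
  assumes A: "A \<subseteq> {0..<n}" and f: "bij_betw f {0..<r} A"
    and rows: "\<And>i j. i < n \<Longrightarrow> j < n \<Longrightarrow> i \<notin> A \<Longrightarrow> g i j = (if i = j then 1 else 0)"
  shows "det (mat n n (\<lambda>(i, j). g i j)) = det (mat r r (\<lambda>(i, j). g (f i) (f j)))"
proof -
  have finA: "finite A" using A by (rule finite_subset) simp
  have inj: "inj_on f {0..<r}" and im: "f ` {0..<r} = A" using f by (auto simp: bij_betw_def)
  let ?t = "\<lambda>S p. signof p * (\<Prod>i\<in>S. g i (p i))"
  have "det (mat n n (\<lambda>(i, j). g i j)) = (\<Sum>p\<in>{p. p permutes A}. ?t {0..<n} p)"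
    unfolding det_mat_fun
  proof (rule sum.mono_neutral_right)
    show "{p. p permutes A} \<subseteq> {p. p permutes {0..<n}}" using A by (auto intro: permutes_subset)
    show "\<forall>p\<in>{p. p permutes {0..<n}} - {p. p permutes A}. ?t {0..<n} p = 0"
    proof
      fix p assume "p \<in> {p. p permutes {0..<n}} - {p. p permutes A}"
      then have p: "p permutes {0..<n}" "\<not> p permutes A" by auto
      then obtain i where i: "i \<notin> A" "p i \<noteq> i" using permutes_superset[OF p(1), of A] by auto
      then have "i < n" using permutes_not_in[OF p(1), of i] by auto
      moreover from this have "p i < n" using permutes_in_image[OF p(1), of i] by simp
      ultimately have "g i (p i) = 0" using rows[of i "p i"] i by simp
      then have "(\<Prod>i\<in>{0..<n}. g i (p i)) = 0" using \<open>i < n\<close> by (intro prod_zero) auto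
      then show "?t {0..<n} p = 0" by simp
    qed
  qed (simp add: finite_permutations)
  also have "\<dots> = (\<Sum>p\<in>{p. p permutes A}. ?t A p)"
  proof (intro sum.cong refl)
    fix p assume "p \<in> {p. p permutes A}"
    then have p: "p permutes A" by simp
    have "(\<Prod>i\<in>{0..<n}. g i (p i)) = (\<Prod>i\<in>A. g i (p i))"
      by (rule prod.mono_neutral_right) (use A rows permutes_not_in[OF p] in auto)
    then show "?t {0..<n} p = ?t A p" by simp
  qed
  also have "\<dots> = (\<Sum>p\<in>{p. p permutes {0..<r}}. ?t A (map_permutation {0..<r} f p))"
  proof (rule sum.reindex_bij_betw[symmetric])
    have "(\<lambda>\<pi> x. if x \<in> A then f (\<pi> (inv_into {0..<r} f x)) else x) = map_permutation {0..<r} f"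
      by (auto simp: map_permutation_def restrict_id_def im fun_eq_iff)
    then show "bij_betw (map_permutation {0..<r} f) {p. p permutes {0..<r}} {p. p permutes A}"
      using bij_betw_permutations[OF f] by simp
  qed
  also have "\<dots> = (\<Sum>p\<in>{p. p permutes {0..<r}}. signof p * (\<Prod>i\<in>{0..<r}. g (f i) (f (p i))))"
  proof (intro sum.cong refl arg_cong2[where f = "(*)"])
    fix p assume "p \<in> {p. p permutes {0..<r}}"
    then have p: "p permutes {0..<r}" by simp
    show "signof (map_permutation {0..<r} f p) = (signof p :: 'a)"
      by (simp add: sign_map_permutation[OF inj p])
    have "(\<Prod>i\<in>A. g i (map_permutation {0..<r} f p i)) =
        (\<Prod>i\<in>{0..<r}. g (f i) (map_permutation {0..<r} f p (f i)))"
      by (rule prod.reindex_bij_betw[OF f, symmetric])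
    also have "\<dots> = (\<Prod>i\<in>{0..<r}. g (f i) (f (p i)))"
      by (intro prod.cong refl) (simp add: map_permutation_apply[OF inj])
    finally show "(\<Prod>i\<in>A. g i (map_permutation {0..<r} f p i)) = (\<Prod>i\<in>{0..<r}. g (f i) (f (p i)))" .
  qed
  finally show ?thesis unfolding det_mat_fun .
qed

section \<open>Division by t^r and evaluation at t = 0\<close>

text \<open>The quotient of h_n(1^t) by t, namely (t + 1) ... (t + n - 1) / n! for n > 0. At n = 0,
  where t does not divide, 0 is a default value.\<close>

definition hpoly_div_X :: "int \<Rightarrow> rat poly" where
  "hpoly_div_X n = (if n \<le> 0 then 0 else smult (1 / fact (nat n)) (pochhammer [:1, 1:] (nat n - 1)))"

lemma hpoly_eq_X_mult: "n \<noteq> 0 \<Longrightarrow> hpoly n = [:0, 1:] * hpoly_div_X n"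
proof (cases "n \<le> 0")
  case False
  then obtain k where k: "nat n = Suc k" by (cases "nat n") auto
  have "[:0, 1:] + 1 = ([:1, 1:] :: rat poly)" by (simp add: one_pCons)
  then have "pochhammer [:0, 1:] (Suc k) = [:0, 1:] * pochhammer ([:1, 1:] :: rat poly) k"
    by (simp only: pochhammer_rec)
  then show ?thesis using False k by (simp add: hpoly_def hpoly_div_X_def)
qed (simp add: hpoly_div_X_def)

lemma poly_hpoly_div_X_0: "poly (hpoly_div_X n) 0 = (if 0 < n then 1 / of_int n else 0)"
proof (cases "n \<le> 0")
  case False
  then obtain k where k: "n = int (Suc k)" by (metis gr0_conv_Suc not_le zero_less_imp_eq_int)
  have "poly (hpoly_div_X n) 0 = fact k / fact (Suc k)"
    using k by (simp add: hpoly_div_X_def poly_pochhammer nat_add_distrib flip: pochhammer_fact)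
  also have "\<dots> = 1 / of_int n" by (simp add: k)
  finally show ?thesis using False by simp
qed (simp add: hpoly_div_X_def)

lemma y_value_eq_det:
  assumes sk: "skew_partition l m" and N: "length l \<le> N"
    and rank: "skew_rank l m = card (range (bead l) - range (bead m))"
  shows "y_value l m = det (mat N N (\<lambda>(i, j). if bead l i \<in> range (bead m)
      then if bead l i = bead m j then 1 else 0
      else if bead m j < bead l i then 1 / of_int (bead l i - bead m j) else 0))"
proof -
  define A where "A = {i. bead l i \<notin> range (bead m)}"
  have pl: "is_partition l" and le: "length m \<le> length l"
    using sk length_le_if_dominated[of m l] by (auto simp: skew_partition_beads)
  have AN: "A \<subseteq> {0..<N}"
  proof
    fix i assume i: "i \<in> A"
    have "i < length l"
    proof (rule ccontr)
      assume "\<not> i < length l"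
      then have "bead l i = bead m i" using le bead_beyond[of l i] bead_beyond[of m i] by simp
      then show False using i by (simp add: A_def)
    qed
    then show "i \<in> {0..<N}" using N by simp
  qed
  then have finA: "finite A" by (rule finite_subset) simp
  have "range (bead l) - range (bead m) = bead l ` A" by (auto simp: A_def)
  then have r: "skew_rank l m = card A"
    using rank bead_eq_iff[OF pl] by (simp add: card_image inj_on_def)
  \<comment> \<open>Each row whose bead is not a bead of \<open>m\<close> has only entries with
    nonzero index and releases a factor t; there are r such rows, so their product is t^r.\<close>
  define q where "q i j = (if i \<in> A then hpoly_div_X (bead l i - bead m j) else hpoly (bead l i - bead m j))" for i j
  define c :: "nat \<Rightarrow> rat poly" where "c i = (if i \<in> A then [:0, 1:] else 1)" for i
  have "skew_schur_ones l m = det (mat N N (\<lambda>(i, j). c i * q i j))"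
    unfolding skew_schur_ones_eq_det[OF sk N]
  proof (intro arg_cong[of _ _ det] cong_mat refl, clarify)
    fix i j
    show "hpoly (bead l i - bead m j) = c i * q i j"
    proof (cases "i \<in> A")
      case True
      then have "bead l i - bead m j \<noteq> 0" by (auto simp: A_def)
      from hpoly_eq_X_mult[OF this] show ?thesis using True by (simp add: c_def q_def)
    qed (simp add: c_def q_def)
  qed
  also have "\<dots> = (\<Prod>i\<in>{0..<N}. c i) * det (mat N N (\<lambda>(i, j). q i j))"
    by (rule det_scale_rows)
  also have "(\<Prod>i\<in>{0..<N}. c i) = monom 1 (skew_rank l m)"
  proof -
    have "(\<Prod>i\<in>{0..<N}. c i) = (\<Prod>i\<in>A. [:0, 1:])"
      unfolding c_def by (rule prod.mono_neutral_cong_right) (use AN in auto)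
    also have "\<dots> = monom 1 (card A)" by (simp add: monom_altdef)
    finally show ?thesis using r by simp
  qed
  finally have "y_value l m = poly (det (mat N N (\<lambda>(i, j). q i j))) 0"
    unfolding y_value_def by (simp add: monom_eq_0_iff)
  also have "\<dots> = det (mat N N (\<lambda>(i, j). poly (q i j) 0))" by (rule poly_det)
  also have "\<dots> = det (mat N N (\<lambda>(i, j). if bead l i \<in> range (bead m)
      then if bead l i = bead m j then 1 else 0
      else if bead m j < bead l i then 1 / of_int (bead l i - bead m j) else 0))"
    by (intro arg_cong[of _ _ det] cong_mat refl)
      (auto simp: q_def A_def poly_hpoly_0 poly_hpoly_div_X_0)
  finally show ?thesis .
qed

section \<open>The noncrossing interval set and its determinant\<close>

theorem theorem4p3:
  fixes lam mu :: "nat list" and r :: nat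
    and I0 :: "(nat \<times> nat) set" and w y :: "nat \<Rightarrow> nat"
    and Bs :: "(nat \<times> nat) set list"
  assumes "skew_partition lam mu"
    and "skew_rank lam mu = r"
    and "noncrossing_interval_set lam mu I0"
    and "bij_betw (\<lambda>i. (w i, y i)) {0..<r} I0"
    and "greedy_decomposition lam mu Bs"
  shows "y_value lam mu =
    (-1) ^ height_sum Bs *
    det (mat r r (\<lambda>(i, j). if y j > w i then 1 / (of_nat (y j) - of_nat (w i)) else (0::rat)))"
proof -
  note sk = assms(1)
  let ?L = "bead lam" and ?M = "bead mu" and ?N = "length lam"
  have pl: "is_partition lam" and pm: "is_partition mu" using sk by (auto simp: skew_partition_beads)
  obtain p where p: "p permutes {0..<?N}" and sign_p: "sign p = (-1) ^ height_sum Bs"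
    and match: "noncrossing_matching lam mu p" and fin: "finite (range ?L - range ?M)"
    using greedy_decomposition_matching[OF assms(5) order_refl] by blast
  have rank: "skew_rank lam mu = card (range ?L - range ?M)"
    by (rule skew_rank_eq_card_beads[OF sk assms(5)])
  have match1: "?M (p i) \<le> ?L i"
    and match2: "?L i \<in> range ?M \<Longrightarrow> ?M (p i) = ?L i"
    and match4: "\<not> (?M (p i) < ?M (p j) \<and> ?M (p j) < ?L i \<and> ?L i < ?L j)" for i j
    using match unfolding noncrossing_matching_def by blast+
  define A where "A = {i. ?L i \<notin> range ?M}"
  have ne: "?M j \<noteq> ?L i" if "i \<in> A" for i j using that by (simp add: A_def) (metis rangeI)
  have AN: "A \<subseteq> {0..<?N}"
  proof
    fix i assume i: "i \<in> A"
    show "i \<in> {0..<?N}"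
    proof (rule ccontr)
      assume "i \<notin> {0..<?N}"
      moreover have "length mu \<le> ?N"
        using sk length_le_if_dominated[of mu lam] by (simp add: skew_partition_beads)
      ultimately have "?L i = ?M i" using bead_beyond[of lam i] bead_beyond[of mu i] by simp
      then show False using i by (simp add: A_def)
    qed
  qed
  then have finA: "finite A" by (rule finite_subset) simp
  have pinj: "p i = p j \<longleftrightarrow> i = j" for i j using permutes_inj[OF p] by (auto simp: inj_eq)
  \<comment> \<open>The pairs of the greedy matching other than the pairs of common beads, written
    as bead positions.\<close>
  define J where "J = (\<lambda>i. (?M (p i), ?L i)) ` A"
  have sndJ: "snd ` J = range ?L - range ?M" by (auto simp: J_def A_def image_image)
  have fstJ: "fst ` J = range ?M - range ?L"
  proof (intro equalityI subsetI)
    fix x assume "x \<in> fst ` J"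
    then obtain i where i: "i \<in> A" "x = ?M (p i)" by (auto simp: J_def)
    have "x \<noteq> ?L k" for k
    proof
      assume "x = ?L k"
      then have "?M (p k) = ?M (p i)" using match2[of k] i by (metis rangeI)
      then have "k = i" using bead_eq_iff[OF pm] pinj by simp
      then show False using \<open>x = ?L k\<close> i ne by simp
    qed
    then show "x \<in> range ?M - range ?L" using i by auto
  next
    fix x assume x: "x \<in> range ?M - range ?L"
    then obtain j where j: "x = ?M j" by auto
    obtain i where i: "j = p i" using permutes_surj[OF p] by (metis surjD)
    have "i \<in> A" using match2[of i] x i j by (auto simp: A_def)
    then show "x \<in> fst ` J" using i j by (force simp: J_def)
  qed
  have injJ: "inj_on fst J" "inj_on snd J"
    using bead_eq_iff[OF pm] bead_eq_iff[OF pl] pinj by (auto simp: J_def inj_on_def)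
  have cardJ: "card J = r" "card (range ?M - range ?L) = r" "card (range ?L - range ?M) = r"
    using card_image[OF injJ(1)] card_image[OF injJ(2)] fstJ sndJ rank assms(2) by auto
  have finJ: "finite J" using finA by (simp add: J_def)
  obtain off where offL: "\<And>u n. 1 \<le> u \<Longrightarrow> u \<le> length (snake_sequence lam mu) \<Longrightarrow>
      snake_sequence lam mu ! (u - 1) = LSnake n \<Longrightarrow> off + int u \<in> range ?M - range ?L"
    and offR: "\<And>u n. 1 \<le> u \<Longrightarrow> u \<le> length (snake_sequence lam mu) \<Longrightarrow>
      snake_sequence lam mu ! (u - 1) = RSnake n \<Longrightarrow> off + int u \<in> range ?L - range ?M"
    using snake_sequence_beads[OF sk] by blast
  \<comment> \<open>The given intervals, shifted from indices in the snake sequence to bead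
    positions.\<close>
  define K where "K = (\<lambda>(u, v). (off + int u, off + int v)) ` I0"
  have I0: "finite I0" "card I0 = r" "inj_on fst I0" "inj_on snd I0"
    and I0_mem: "\<And>u v. (u, v) \<in> I0 \<Longrightarrow> 1 \<le> u \<and> u < v \<and> v \<le> length (snake_sequence lam mu) \<and>
        (\<exists>n. snake_sequence lam mu ! (u - 1) = LSnake n) \<and>
        (\<exists>n. snake_sequence lam mu ! (v - 1) = RSnake n)"
    and I0_nc: "\<And>u v u' v'. (u, v) \<in> I0 \<Longrightarrow> (u', v') \<in> I0 \<Longrightarrow> \<not> (u < u' \<and> u' < v \<and> v < v')"
    using assms(2,3) unfolding noncrossing_interval_set_def interval_set_def by blast+
  have injK: "inj_on fst K" "inj_on snd K"
    using inj_onD[OF I0(3)] inj_onD[OF I0(4)] by (force simp: K_def inj_on_def)+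
  have cardK: "card K = r"
    using I0(2) by (subst K_def, subst card_image) (auto simp: inj_on_def)
  \<comment> \<open>Left snakes give the inclusion; both sets have r elements, so they are equal.
    The closing ends are treated in the same way.\<close>
  have fstK: "fst ` K = range ?M - range ?L"
  proof (rule card_subset_eq)
    show "finite (range ?M - range ?L)" using finJ fstJ by (metis finite_imageI)
    show "fst ` K \<subseteq> range ?M - range ?L"
    proof
      fix x assume "x \<in> fst ` K"
      then obtain u v where "(u, v) \<in> I0" "x = off + int u" by (auto simp: K_def)
      then show "x \<in> range ?M - range ?L" using I0_mem[of u v] offL[of u] by force
    qed
    show "card (fst ` K) = card (range ?M - range ?L)"
      using card_image[OF injK(1)] cardK cardJ by simp
  qed
  have sndK: "snd ` K = range ?L - range ?M"
  proof (rule card_subset_eq[OF fin])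
    show "snd ` K \<subseteq> range ?L - range ?M"
    proof
      fix x assume "x \<in> snd ` K"
      then obtain u v where "(u, v) \<in> I0" "x = off + int v" by (auto simp: K_def)
      then show "x \<in> range ?L - range ?M" using I0_mem[of u v] offR[of v] by force
    qed
    show "card (snd ` K) = card (range ?L - range ?M)"
      using card_image[OF injK(2)] cardK cardJ by simp
  qed
  have "K = J"
  proof (rule noncrossing_unique)
    show "finite K" using I0(1) by (simp add: K_def)
    show "u < v" if "(u, v) \<in> K" for u v using that I0_mem by (auto simp: K_def)
    show "u < v" if uv: "(u, v) \<in> J" for u v
    proof -
      obtain i where i: "i \<in> A" "u = ?M (p i)" "v = ?L i" using uv by (auto simp: J_def)
      then have "u \<noteq> v" using ne by simp
      then show ?thesis using match1[of i] i by simp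
    qed
    show "\<not> (u < u' \<and> u' < v \<and> v < v')" if "(u, v) \<in> K" "(u', v') \<in> K" for u v u' v'
      using that I0_nc by (fastforce simp: K_def)
    show "\<not> (u < u' \<and> u' < v \<and> v < v')" if "(u, v) \<in> J" "(u', v') \<in> J" for u v u' v'
      using that match4 by (auto simp: J_def)
  qed (use finJ injJ injK fstJ fstK sndJ sndK in auto)
  have "\<exists>k. k \<in> A \<and> ?M (p k) = off + int (w i) \<and> ?L k = off + int (y i)" if "i < r" for i
  proof -
    have "(w i, y i) \<in> I0" using assms(4) that by (auto simp: bij_betw_def)
    then have "(off + int (w i), off + int (y i)) \<in> J" using \<open>K = J\<close> by (force simp: K_def)
    then show ?thesis by (auto simp: J_def)
  qed
  \<comment> \<open>\<open>f i\<close> is the row whose bead closes the interval with number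
    \<open>i\<close>.\<close>
  then obtain f where f: "\<And>i. i < r \<Longrightarrow> f i \<in> A \<and> ?M (p (f i)) = off + int (w i) \<and> ?L (f i) = off + int (y i)"
    by metis
  have "inj_on f {0..<r}"
  proof (rule inj_onI)
    fix i j assume ij: "i \<in> {0..<r}" "j \<in> {0..<r}" "f i = f j"
    then have "(w i, y i) = (w j, y j)" using f[of i] f[of j] by simp
    then show "i = j" using assms(4) ij by (auto simp: bij_betw_def inj_on_def)
  qed
  moreover have "card A = r"
    using cardJ(1) bead_eq_iff[OF pl] by (simp add: J_def card_image inj_on_def)
  ultimately have bij: "bij_betw f {0..<r} A"
    using f finA by (intro bij_betw_imageI card_subset_eq) (auto simp: card_image)
  let ?G = "\<lambda>i j. if ?L i \<in> range ?M then if ?L i = ?M j then 1 else 0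
      else if ?M j < ?L i then 1 / of_int (?L i - ?M j) else (0::rat)"
  \<comment> \<open>Arranging the columns by \<open>p\<close> puts the 1 of every common bead on the
    diagonal, so only the minor on \<open>A\<close> survives.\<close>
  have "det (mat ?N ?N (\<lambda>(i, j). ?G i (p j))) = det (mat r r (\<lambda>(i, j). ?G (f i) (p (f j))))"
  proof (rule det_principal_minor[OF AN bij])
    fix i j assume "i < ?N" "j < ?N" "i \<notin> A"
    then have i: "?L i \<in> range ?M" by (simp add: A_def)
    then have "?L i = ?M (p j) \<longleftrightarrow> i = j" using match2[OF i] bead_eq_iff[OF pm] pinj by metis
    then show "?G i (p j) = (if i = j then 1 else 0)" using i by simp
  qed
  \<comment> \<open>Rows of this minor belong to the right ends \<open>y\<close> and columns to the
    left ends \<open>w\<close>, hence the transpose. The offset cancels in the differences.\<close>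
  also have "mat r r (\<lambda>(i, j). ?G (f i) (p (f j))) =
      transpose_mat (mat r r (\<lambda>(i, j). if y j > w i then 1 / (of_nat (y j) - of_nat (w i)) else 0))"
    (is "_ = transpose_mat ?D")
  proof (rule eq_matI)
    fix i j assume "i < dim_row (transpose_mat ?D)" "j < dim_col (transpose_mat ?D)"
    then have ij: "i < r" "j < r" by auto
    have "f i \<in> A" and L: "?L (f i) = off + int (y i)" using f[OF ij(1)] by blast+
    then have "off + int (y i) \<notin> range ?M" unfolding L[symmetric] by (simp add: A_def)
    then show "mat r r (\<lambda>(i, j). ?G (f i) (p (f j))) $$ (i, j) = transpose_mat ?D $$ (i, j)"
      using ij f[OF ij(1)] f[OF ij(2)] by simp
  qed auto
  also have "det \<dots> = det ?D" by (rule det_transpose) auto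
  finally have D: "signof p * det (mat ?N ?N (\<lambda>(i, j). ?G i j)) = det ?D"
    using det_mat_permute_columns[OF p, of ?G] by simp
  have s: "(signof p :: rat) = (-1) ^ height_sum Bs" using sign_p by simp
  have "y_value lam mu = det (mat ?N ?N (\<lambda>(i, j). ?G i j))"
    by (rule y_value_eq_det[OF sk order_refl rank])
  also have "\<dots> = (-1) ^ height_sum Bs * ((-1) ^ height_sum Bs * det (mat ?N ?N (\<lambda>(i, j). ?G i j)))"
    by (simp add: mult.assoc[symmetric] power_mult_distrib[symmetric])
  also have "\<dots> = (-1) ^ height_sum Bs * det ?D" using D s by simp
  finally show ?thesis .
qed

end
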